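(* Let $p\ge 1$ be an integer. A LIRK-W method of type 3 with $s$ stages and real coefficients $a_{i,j},\gamma_{i,j},b_i,g_i$ has order $p$ if and only if $$\sum_{j=1}^s \Phi^3_j(\tau)=\frac{1}{\gamma(\tau)}\qquad\text{for all } \tau\in T \text{ with } \rho(\tau)\le p,$$ and $$\sum_{j=1}^s \Phi^3_j(\tau)=0\qquad\text{for all } \tau\in LW_3\setminus T \text{ with } \rho(\tau)\le p.$$
   Context: **Problem.** Consider the autonomous initial value problem $y'=F(y)$, $y(t_n)=y_n$, with $F:\mathbb{R}^N\to\mathbb{R}^N$ smooth, and let $t\mapsto \mathbf{L}(t)\in\mathbb{R}^{N\times N}$ be an arbitrary smooth time-dependent matrix. **Method.** Coefficients are real numbers $a_{i,j}$ ($1\le j<i\le s$), $\gamma_{i,j}$ ($1\le j\le i\le s$), $b_i,g_i$ ($1\le i\le s$), with $a_{i,j}=0$ for $j\ge i$ and $\gamma_{i,j}=0$ for $j>i$. One step of size $h$ of the LIRK-W (linearly-implicit Runge-Kutta-W) method of type 3 is $$Y_i=y_n+h\sum_{j=1}^{i-1}a_{i,j}F(Y_j)+h\,\mathbf{L}_i\sum_{j=1}^{i}\gamma_{i,j}Y_j\quad(i=1,\dots,s),$$ $$y_{n+1}=y_n+h\sum_{j=1}^s b_jF(Y_j)+h\,\mathbf{L}\sum_{j=1}^s g_jY_j,\qquad \mathbf{L}=\mathbf{L}(t_n),\quad \mathbf{L}_i=\mathbf{L}(t_n+h\gamma_{i,i}).$$ (For $h$ small the stages are well defined.) The method has order $p$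 if, for every $N$, every smooth $F$, every smooth $\mathbf{L}(\cdot)$ and every $t_n,y_n$, the Taylor expansions in $h$ at $h=0$ of $y_{n+1}$ and of the exact solution $y(t_n+h)$ agree up to and including the $h^p$ terms, i.e. $y_{n+1}-y(t_n+h)=O(h^{p+1})$. **Trees.** Consider finite nonempty rooted trees (unordered, up to isomorphism) whose vertices are each of one of three kinds: meagre, fat, or square. $LW_3$ is the set of such trees in which the root is not square, every fat vertex has at most one child, and every square vertex has exactly one child, which is square or fat; meagre vertices may have any number of children of any kind. $T\subset LW_3$ is the set of trees all of whose vertices are meagre. Notation: $[\,]_\bullet$ is the single meagre vertex and $[\tau_1,\dots,\tau_m]_\bullet$ is the tree obtained by attaching $\tau_1,\dots,\tau_m$ to a meagre root; $[\,]_\circ$ is the single fat vertex and $[\tau_1]_\circ$ attaches $\tau_1$ to a fat root; for $q\ge1$, $[\tau_1]_{\theta_q}$ (resp. $[\,]_{\theta_q}$) is the tree consisting of a chain of $q$ square vertices starting at the root, followed by a fat vertex, to which $\tau_1$ (resp. nothing) is attached. Subtrees of a tree in $LW_3$ may be of the form $[\cdot]_{\theta_q}$, although the tree itself may not. $\rho(\tau)$ is the number of vertices of $\tau$ (all kinds counted). For $\tau\in T$, $\gamma(\tau)$ is defined by $\gamma([\,]_\bullet)=1$ and $\gamma([\tau_1,\dots,\tau_m]_\bullet)=\rho(\tau)\gamma(\tau_1)\cdots\gamma(\tau_m)$ (not to be confused with the coefficients $\gamma_{i,j}$). **Elementary weights** (all sums over $k$ from $1$ to $s$): - $\Phi^3_j([\,]_\bullet)=b_j$;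 $\ \Phi^3_j([\tau_1,\dots,\tau_m]_\bullet)=b_j\,\bar\Phi^3_j(\tau_1)\cdots\bar\Phi^3_j(\tau_m)$; - $\Phi^3_j([\,]_\circ)=g_j$; $\ \Phi^3_j([\tau_1]_\circ)=g_j\,\bar\Phi^3_j(\tau_1)$; - $\bar\Phi^3_j([\,]_\bullet)=\sum_k a_{j,k}$; $\ \bar\Phi^3_j([\tau_1,\dots,\tau_m]_\bullet)=\sum_k a_{j,k}\,\bar\Phi^3_k(\tau_1)\cdots\bar\Phi^3_k(\tau_m)$; - $\bar\Phi^3_j([\,]_\circ)=\sum_k\gamma_{j,k}$; $\ \bar\Phi^3_j([\tau_1]_\circ)=\sum_k\gamma_{j,k}\,\bar\Phi^3_k(\tau_1)$; - $\bar\Phi^3_j([\,]_{\theta_q})=\sum_k\gamma_{j,j}^{q}\gamma_{j,k}$; $\ \bar\Phi^3_j([\tau_1]_{\theta_q})=\sum_k\gamma_{j,j}^{q}\gamma_{j,k}\,\bar\Phi^3_k(\tau_1)$. *)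

theory Defs
  imports "HOL-Analysis.Analysis" "HOL-Library.Multiset" "HOL-Library.Landau_Symbols"
begin

section \<open>Smooth functions on \<open>\<real>\<^sup>N\<close>\<close>

text \<open>The order of a method quantifies over all dimensions \<open>N\<close>, so \<open>\<real>\<^sup>N\<close> cannot be a type indexed
  by its dimension.  It is the carrier of \<^const>\<open>Euclidean_space\<close>: sequences
  \<open>x :: nat \<Rightarrow> real\<close> with \<open>x i = 0\<close> for \<open>i \<ge> N\<close>, so coordinates are numbered from \<open>0\<close>.\<close>

abbreviation RN :: "nat \<Rightarrow> (nat \<Rightarrow> real) set" where
  "RN N \<equiv> topspace (Euclidean_space N)"

definition partial_deriv :: "nat \<Rightarrow> ((nat \<Rightarrow> real) \<Rightarrow> real) \<Rightarrow> (nat \<Rightarrow> real) \<Rightarrow> real" where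
  "partial_deriv i f x = deriv (\<lambda>t. f (x(i := t))) (x i)"

text \<open>All iterated partial derivatives exist and are continuous.\<close>

definition smooth_RN :: "nat \<Rightarrow> ((nat \<Rightarrow> real) \<Rightarrow> real) \<Rightarrow> bool" where
  "smooth_RN N f \<longleftrightarrow>
     (\<forall>ks. set ks \<subseteq> {..<N} \<longrightarrow>
        continuous_map (Euclidean_space N) euclideanreal (fold partial_deriv ks f) \<and>
        (\<forall>x\<in>RN N. \<forall>i<N. (\<lambda>t. fold partial_deriv ks f (x(i := t))) differentiable (at (x i))))"

definition smooth_vector_field :: "nat \<Rightarrow> ((nat \<Rightarrow> real) \<Rightarrow> nat \<Rightarrow> real) \<Rightarrow> bool" where
  "smooth_vector_field N F \<longleftrightarrow> F \<in> RN N \<rightarrow> RN N \<and> (\<forall>\<nu><N. smooth_RN N (\<lambda>x. F x \<nu>))"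

text \<open>\<open>L t \<nu> \<mu>\<close> is the entry of the matrix \<open>L(t)\<close> in row \<open>\<nu>\<close> and column \<open>\<mu>\<close>; only the entries with
  \<open>\<nu>, \<mu> < N\<close> matter.\<close>

definition smooth_matrix :: "nat \<Rightarrow> (real \<Rightarrow> nat \<Rightarrow> nat \<Rightarrow> real) \<Rightarrow> bool" where
  "smooth_matrix N L \<longleftrightarrow>
     (\<forall>\<nu><N. \<forall>\<mu><N. \<forall>k. (deriv ^^ k) (\<lambda>t. L t \<nu> \<mu>) differentiable_on UNIV)"

definition mat_vec :: "nat \<Rightarrow> (nat \<Rightarrow> nat \<Rightarrow> real) \<Rightarrow> (nat \<Rightarrow> real) \<Rightarrow> nat \<Rightarrow> real" where
  "mat_vec N M x \<nu> = (\<Sum>\<mu><N. M \<nu> \<mu> * x \<mu>)"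


section \<open>LIRK-W methods of type 3 and their order\<close>

text \<open>Stages are numbered \<open>1, \<dots>, s\<close>.  The stage equations are implicit, hence a step is a relation:
  \<open>z\<close> is a result of one step of size \<open>h\<close> from \<open>(tn, yn)\<close>.\<close>

definition lirkw_step ::
  "nat \<Rightarrow> (nat \<Rightarrow> nat \<Rightarrow> real) \<Rightarrow> (nat \<Rightarrow> nat \<Rightarrow> real) \<Rightarrow> (nat \<Rightarrow> real) \<Rightarrow> (nat \<Rightarrow> real) \<Rightarrow>
   nat \<Rightarrow> ((nat \<Rightarrow> real) \<Rightarrow> nat \<Rightarrow> real) \<Rightarrow> (real \<Rightarrow> nat \<Rightarrow> nat \<Rightarrow> real) \<Rightarrow>
   real \<Rightarrow> (nat \<Rightarrow> real) \<Rightarrow> real \<Rightarrow> (nat \<Rightarrow> real) \<Rightarrow> bool" where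
  "lirkw_step s a gam b g N F L tn yn h z \<longleftrightarrow>
     z \<in> RN N \<and>
     (\<exists>Y. (\<forall>i\<in>{1..s}. Y i \<in> RN N \<and>
            (\<forall>\<nu><N. Y i \<nu> = yn \<nu> + h * (\<Sum>j\<in>{1..<i}. a i j * F (Y j) \<nu>)
               + h * mat_vec N (L (tn + h * gam i i)) (\<lambda>\<mu>. \<Sum>j=1..i. gam i j * Y j \<mu>) \<nu>)) \<and>
          (\<forall>\<nu><N. z \<nu> = yn \<nu> + h * (\<Sum>j=1..s. b j * F (Y j) \<nu>)
               + h * mat_vec N (L tn) (\<lambda>\<mu>. \<Sum>j=1..s. g j * Y j \<mu>) \<nu>))"

text \<open>\<open>y\<close> is an exact solution of \<open>y' = F(y)\<close>, \<open>y(tn) = yn\<close> near \<open>tn\<close>.\<close>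

definition local_solution ::
  "nat \<Rightarrow> ((nat \<Rightarrow> real) \<Rightarrow> nat \<Rightarrow> real) \<Rightarrow> real \<Rightarrow> (nat \<Rightarrow> real) \<Rightarrow> (real \<Rightarrow> nat \<Rightarrow> real) \<Rightarrow> bool" where
  "local_solution N F tn yn y \<longleftrightarrow>
     y tn = yn \<and>
     (\<exists>\<epsilon>>0. \<forall>t. \<bar>t - tn\<bar> < \<epsilon> \<longrightarrow>
        y t \<in> RN N \<and> (\<forall>\<nu><N. ((\<lambda>\<tau>. y \<tau> \<nu>) has_real_derivative F (y t) \<nu>) (at t)))"

text \<open>For small \<open>h\<close> the step relation determines a unique result, and a smooth \<open>F\<close> admits a local solution
  that is unique near \<open>tn\<close>; so \<open>z\<close> is \<open>y\<^bsub>n+1\<^esub>\<close> as a function of \<open>h\<close> and \<open>y\<close> is the exact solution.\<close>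

definition lirkw_has_order ::
  "nat \<Rightarrow> (nat \<Rightarrow> nat \<Rightarrow> real) \<Rightarrow> (nat \<Rightarrow> nat \<Rightarrow> real) \<Rightarrow> (nat \<Rightarrow> real) \<Rightarrow> (nat \<Rightarrow> real) \<Rightarrow> nat \<Rightarrow> bool"
  where
  "lirkw_has_order s a gam b g p \<longleftrightarrow>
     (\<forall>N F L tn yn y z.
        smooth_vector_field N F \<longrightarrow> smooth_matrix N L \<longrightarrow> yn \<in> RN N \<longrightarrow>
        local_solution N F tn yn y \<longrightarrow>
        (\<forall>\<^sub>F h in nhds 0. lirkw_step s a gam b g N F L tn yn h (z h)) \<longrightarrow>
        (\<forall>\<nu><N. (\<lambda>h. z h \<nu> - y (tn + h) \<nu>) \<in> O[at 0](\<lambda>h. h ^ (p + 1))))"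


section \<open>Trees\<close>

datatype kind = Meagre | Fat | Square

datatype tree = Node (root: kind) (children: "tree multiset")

primrec subtrees :: "tree \<Rightarrow> tree set" where
  "subtrees (Node c ts) = insert (Node c ts) (\<Union> (set_mset (image_mset subtrees ts)))"

text \<open>Vertices of a tree correspond to its (complete) subtrees, so conditions on all vertices are
  conditions on the roots of all subtrees.\<close>

definition LW3 :: "tree set" where
  "LW3 = {\<tau>. root \<tau> \<noteq> Square \<and>
     (\<forall>\<sigma>\<in>subtrees \<tau>.
        (root \<sigma> = Fat \<longrightarrow> size (children \<sigma>) \<le> 1) \<and>
        (root \<sigma> = Square \<longrightarrow> (\<exists>\<sigma>'. children \<sigma> = {#\<sigma>'#} \<and> root \<sigma>' \<in> {Square, Fat})))}"

definition meagre_trees :: "tree set" where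
  "meagre_trees = {\<tau> \<in> LW3. \<forall>\<sigma>\<in>subtrees \<tau>. root \<sigma> = Meagre}"

primrec tree_order :: "tree \<Rightarrow> nat" where
  "tree_order (Node c ts) = 1 + sum_mset (image_mset tree_order ts)"

text \<open>The density \<open>\<gamma>(\<tau>)\<close>, meaningful for \<open>\<tau> \<in> meagre_trees\<close>.\<close>

primrec tree_density :: "tree \<Rightarrow> nat" where
  "tree_density (Node c ts) = tree_order (Node c ts) * prod_mset (image_mset tree_density ts)"


section \<open>Elementary weights\<close>

text \<open>Each square vertex contributes one factor \<open>\<gamma>\<^sub>j\<^sub>j\<close>; over a chain of \<open>q\<close> squares this gives the factor
  \<open>\<gamma>\<^sub>j\<^sub>j\<^sup>q\<close>, see \<open>Phi_bar_theta\<close> below.\<close>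

primrec Phi_bar :: "nat \<Rightarrow> (nat \<Rightarrow> nat \<Rightarrow> real) \<Rightarrow> (nat \<Rightarrow> nat \<Rightarrow> real) \<Rightarrow> tree \<Rightarrow> nat \<Rightarrow> real" where
  "Phi_bar s a gam (Node c ts) = (\<lambda>j.
     case c of
       Meagre \<Rightarrow> (\<Sum>k=1..s. a j k * prod_mset (image_mset (\<lambda>w. w k) (image_mset (Phi_bar s a gam) ts)))
     | Fat \<Rightarrow> (\<Sum>k=1..s. gam j k * prod_mset (image_mset (\<lambda>w. w k) (image_mset (Phi_bar s a gam) ts)))
     | Square \<Rightarrow> gam j j * prod_mset (image_mset (\<lambda>w. w j) (image_mset (Phi_bar s a gam) ts)))"

text \<open>No value is specified for a square root.\<close>

fun Phi ::
  "nat \<Rightarrow> (nat \<Rightarrow> nat \<Rightarrow> real) \<Rightarrow> (nat \<Rightarrow> nat \<Rightarrow> real) \<Rightarrow> (nat \<Rightarrow> real) \<Rightarrow> (nat \<Rightarrow> real) \<Rightarrow> tree \<Rightarrow> nat \<Rightarrow> real"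
  where
  "Phi s a gam b g (Node Meagre ts) j = b j * (\<Prod>\<tau>\<in>#ts. Phi_bar s a gam \<tau> j)"
| "Phi s a gam b g (Node Fat ts) j = g j * (\<Prod>\<tau>\<in>#ts. Phi_bar s a gam \<tau> j)"

definition theta :: "nat \<Rightarrow> tree multiset \<Rightarrow> tree" where
  "theta q ts = ((\<lambda>\<tau>. Node Square {#\<tau>#}) ^^ q) (Node Fat ts)"

lemma Phi_bar_Meagre:
  "Phi_bar s a gam (Node Meagre ts) j = (\<Sum>k=1..s. a j k * (\<Prod>\<tau>\<in>#ts. Phi_bar s a gam \<tau> k))"
  by (simp add: multiset.map_comp comp_def)

lemma Phi_bar_Fat:
  "Phi_bar s a gam (Node Fat {#}) j = (\<Sum>k=1..s. gam j k)"
  "Phi_bar s a gam (Node Fat {#\<tau>#}) j = (\<Sum>k=1..s. gam j k * Phi_bar s a gam \<tau> k)"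
  by simp_all

lemma Phi_bar_theta:
  "Phi_bar s a gam (theta q {#}) j = (\<Sum>k=1..s. gam j j ^ q * gam j k)"
  "Phi_bar s a gam (theta q {#\<tau>#}) j = (\<Sum>k=1..s. gam j j ^ q * gam j k * Phi_bar s a gam \<tau> k)"
  by (induction q) (simp_all add: theta_def sum_distrib_left mult.assoc)

end

theory Submission
  imports Defs
begin

text \<open>
  The method and the exact solution are compared through one and the same expansion.  Give the exact
  solution the index \<open>0\<close> and the stages the indices \<open>1, \<dots>, s\<close>.  For a tree \<open>\<tau>\<close> the index \<open>i\<close> carries a
  weight: \<open>Phi_bar s a gam \<tau> i\<close> for a stage, and for the exact solution \<open>1 / \<gamma>(\<tau>)\<close> if all vertices
  are meagre and \<open>0\<close> otherwise (\<open>exact_weight\<close>).  Up to \<open>O(h\<^sup>m)\<close>, every component of \<open>Y\<^sub>i - y\<^sub>n\<close> and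
  of \<open>y(t\<^sub>n + h) - y\<^sub>n\<close> is a linear combination of the terms \<open>h\<^bsup>\<rho>(\<tau>)\<^esup> weight i \<tau>\<close>, with coefficients
  that do not depend on \<open>i\<close>.  They are built from elementary differentials, but what makes the comparison
  possible is only that they are shared.  This is \<open>expands_V\<close>, proved by bootstrapping in \<open>m\<close>.

  Three closure properties carry the bootstrapping.  A product of two expansions is an expansion
  over forests, because the union of forests multiplies weights and adds orders; so a smooth
  function, replaced by a Taylor polynomial, maps expansions to expansions, and no symmetry
  coefficients appear (\<open>expands_polyfun\<close>, \<open>expands_smooth_RN\<close>).  Applying \<open>h \<Sum>\<^sub>j a\<^sub>i\<^sub>j\<close> to the stages and
  integrating the exact solution grafts a forest onto a meagre root, for all indices at once
  (\<open>expands_graft_Meagre\<close>).  Applying the Taylor term of degree \<open>q\<close> of \<open>h L\<^sub>i \<Sum>\<^sub>j \<gamma>\<^sub>i\<^sub>j\<close> grafts a tree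
  below \<open>q\<close> square vertices and a fat one (\<open>expands_graft_matrix_entry\<close>); the exact solution does not
  see \<open>L\<close>, in accordance with its weight \<open>0\<close> for such trees.  Each graft gains one power of \<open>h\<close>.
  In the formula for \<open>y\<^bsub>n+1\<^esub>\<close> a last graft creates the root, and the tree \<open>\<tau>\<close> contributes to the error
  a multiple of \<open>h\<^bsup>\<rho>(\<tau>)\<^esup> (\<Sum>\<^sub>j \<Phi>\<^sub>j(\<tau>) - exact_weight \<tau>)\<close>.  The order conditions remove these terms for
  \<open>\<rho>(\<tau>) \<le> p\<close>, which is sufficiency (\<open>order_if_conditions\<close>).

  For necessity each \<open>\<tau>\<close> gets its own initial value problem.  Its coordinates are the subtrees of
  \<open>\<tau>\<close> together with one constant coordinate; \<open>F\<close> multiplies the coordinates of the children of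
  a meagre vertex, and \<open>L\<close> has an entry \<open>t\<^sup>q\<close> for each fat vertex below \<open>q\<close> squares.  Then the
  coordinate \<open>\<sigma>\<close> of the stage or solution with index \<open>i\<close> equals \<open>h\<^bsup>\<rho>(\<sigma>)\<^esup> weight i \<sigma>\<close> exactly, the
  error in the coordinate \<open>\<tau>\<close> is \<open>h\<^bsup>\<rho>(\<tau>)\<^esup> (\<Sum>\<^sub>j \<Phi>\<^sub>j(\<tau>) - exact_weight \<tau>)\<close>, and order \<open>p \<ge> \<rho>(\<tau>)\<close> forces
  the bracket to vanish (\<open>condition_if_order\<close>).
\<close>

section \<open>Polynomial functions and Taylor expansion\<close>

inductive polyfun :: "nat \<Rightarrow> ((nat \<Rightarrow> real) \<Rightarrow> real) \<Rightarrow> bool" for N where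
  const: "polyfun N (\<lambda>x. c)"
| coord: "i < N \<Longrightarrow> polyfun N (\<lambda>x. x i)"
| add: "polyfun N f \<Longrightarrow> polyfun N g \<Longrightarrow> polyfun N (\<lambda>x. f x + g x)"
| mult: "polyfun N f \<Longrightarrow> polyfun N g \<Longrightarrow> polyfun N (\<lambda>x. f x * g x)"

lemma polyfun_sum:
  "(\<And>k. k \<in> K \<Longrightarrow> polyfun N (f k)) \<Longrightarrow> polyfun N (\<lambda>x. \<Sum>k\<in>K. f k x)"
  by (induction K rule: infinite_finite_induct) (auto intro: polyfun.intros)

lemma polyfun_power: "polyfun N f \<Longrightarrow> polyfun N (\<lambda>x. f x ^ k)"
  by (induction k) (auto intro: polyfun.intros)

lemma polyfun_prod_mset:
  "(\<And>k. k \<in># M \<Longrightarrow> polyfun N (f k)) \<Longrightarrow> polyfun N (\<lambda>x. \<Prod>k\<in>#M. f k x)"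
  by (induction M) (auto intro: polyfun.intros)

lemma polyfun_fun_upd_zero: "polyfun N f \<Longrightarrow> polyfun N (\<lambda>x. f (x(k := 0)))"
proof (induction rule: polyfun.induct)
  case (coord i)
  then show ?case by (cases "i = k") (auto intro: polyfun.intros)
qed (auto intro: polyfun.intros)

text \<open>Products are differentiated along the coordinate line, where the product rule of one variable
  applies; hence partial derivatives of polynomial functions exist and are again polynomial.\<close>

lemma polyfun_partial_deriv:
  assumes "polyfun N f"
  shows "\<exists>g. polyfun N g \<and>
    (\<forall>x. ((\<lambda>t. f (x(i := t))) has_real_derivative g x) (at (x i)))"
  using assms
proof induction
  case (const c)
  show ?case by (intro exI[of _ "\<lambda>x. 0"]) (auto intro: polyfun.intros)
next
  case (coord j)
  have "((\<lambda>t. (x(i := t)) j) has_real_derivative (if i = j then 1 else 0)) (at (x i))" for x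
    by (auto intro!: derivative_eq_intros)
  then show ?case
    by (intro exI[of _ "\<lambda>x. if i = j then 1 else 0"]) (auto intro: polyfun.const)
next
  case (add f g)
  then obtain f' g' where *: "polyfun N f'" "polyfun N g'"
    "\<And>x. ((\<lambda>t. f (x(i := t))) has_real_derivative f' x) (at (x i))"
    "\<And>x. ((\<lambda>t. g (x(i := t))) has_real_derivative g' x) (at (x i))"
    by blast
  have "polyfun N (\<lambda>x. f' x + g' x)"
    by (rule polyfun.add[OF *(1,2)])
  moreover have "((\<lambda>t. f (x(i := t)) + g (x(i := t))) has_real_derivative f' x + g' x) (at (x i))" for x
    using DERIV_add[OF *(3)[of x] *(4)[of x]] .
  ultimately show ?case by blast
next
  case (mult f g)
  then obtain f' g' where *: "polyfun N f'" "polyfun N g'"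
    "\<And>x. ((\<lambda>t. f (x(i := t))) has_real_derivative f' x) (at (x i))"
    "\<And>x. ((\<lambda>t. g (x(i := t))) has_real_derivative g' x) (at (x i))"
    by blast
  have "((\<lambda>t. f (x(i := t)) * g (x(i := t))) has_real_derivative (f' x * g x + g' x * f x)) (at (x i))" for x
    using DERIV_mult[OF *(3)[of x] *(4)[of x]] by simp
  moreover have "polyfun N (\<lambda>x. f' x * g x + g' x * f x)"
    using * mult.hyps by (intro polyfun.add polyfun.mult)
  ultimately show ?case by blast
qed

lemma polyfun_continuous_map:
  assumes "polyfun N f"
  shows "continuous_map (Euclidean_space M) euclideanreal f"
  using assms
proof induction
  case (coord i)
  then show ?case
    unfolding Euclidean_space_def
    by (intro continuous_map_from_subtopology continuous_map_product_projection) simp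
qed (auto intro: continuous_map_add continuous_map_real_mult)

lemma smooth_RN_polyfun:
  assumes "polyfun N f"
  shows "smooth_RN N f"
proof -
  have step: "polyfun N (partial_deriv i g)" if g: "polyfun N g" for i g
  proof -
    obtain g' where "polyfun N g'"
      "\<And>x. ((\<lambda>t. g (x(i := t))) has_real_derivative g' x) (at (x i))"
      using polyfun_partial_deriv[OF g] by blast
    moreover from this have "partial_deriv i g = g'"
      unfolding partial_deriv_def by (auto intro!: ext DERIV_imp_deriv)
    ultimately show ?thesis by simp
  qed
  have "polyfun N (fold partial_deriv ks f)" for ks
    using assms by (induction ks arbitrary: f) (auto simp: step)
  moreover have "(\<lambda>t. g (x(i := t))) differentiable (at (x i))" if "polyfun N g" for g x i
    using polyfun_partial_deriv[OF that, of i] real_differentiable_def by blast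
  ultimately show ?thesis
    unfolding smooth_RN_def using polyfun_continuous_map by blast
qed

lemma smooth_RN_partial_deriv_funpow:
  assumes "smooth_RN N f" "k < N"
  shows "smooth_RN N ((partial_deriv k ^^ q) f)"
proof -
  have eq: "fold partial_deriv ks ((partial_deriv k ^^ q) f)
      = fold partial_deriv (replicate q k @ ks) f" for ks
    by (induction q arbitrary: f) (simp_all del: funpow.simps add: funpow_Suc_right)
  have ks: "set (replicate q k @ ks) \<subseteq> {..<N}" if "set ks \<subseteq> {..<N}" for ks
    using assms(2) that by auto
  show ?thesis
    unfolding smooth_RN_def eq using assms(1)[unfolded smooth_RN_def, rule_format, OF ks] by simp
qed

lemma smooth_RN_has_partial_deriv:
  assumes "smooth_RN N f" "k < N" "x \<in> RN N"
  shows "((\<lambda>t. f (x(k := t))) has_real_derivative partial_deriv k f (x(k := t))) (at t)"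
proof -
  have "x(k := t) \<in> RN N" using assms by (auto simp: topspace_Euclidean_space)
  then have "(\<lambda>t'. fold partial_deriv [] f ((x(k := t))(k := t'))) differentiable (at ((x(k := t)) k))"
    using assms unfolding smooth_RN_def by (metis empty_set empty_subsetI)
  then have "(\<lambda>t'. f (x(k := t'))) differentiable (at t)" by simp
  then show ?thesis
    unfolding partial_deriv_def by (simp add: DERIV_deriv_iff_real_differentiable)
qed

text \<open>The topology of \<^const>\<open>Euclidean_space\<close> is the subspace topology of a product, so a neighbourhood of \<open>y\<close>
  constrains each coordinate by an open set.  Coordinates from \<open>N\<close> on vanish on \<open>RN N\<close>, and the first
  \<open>N\<close> ones admit a common radius.\<close>

lemma smooth_RN_locally_bounded:
  assumes "smooth_RN N f" "y \<in> RN N"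
  shows "\<exists>B \<delta>. \<delta> > 0 \<and> (\<forall>x\<in>RN N. (\<forall>i<N. \<bar>x i - y i\<bar> < \<delta>) \<longrightarrow> \<bar>f x\<bar> \<le> B)"
proof -
  have "continuous_map (Euclidean_space N) euclideanreal f"
    using assms(1) unfolding smooth_RN_def by (metis empty_set empty_subsetI fold_Nil id_apply)
  then have "openin (Euclidean_space N) {x \<in> RN N. f x \<in> ball (f y) 1}"
    by (rule openin_continuous_map_preimage) simp
  then have "\<exists>T. openin (powertop_real UNIV) T \<and> {x \<in> RN N. f x \<in> ball (f y) 1} = T \<inter> RN N"
    unfolding topspace_Euclidean_space by (subst (asm) Euclidean_space_def) (simp only: openin_subtopology)
  then obtain T where T: "openin (powertop_real UNIV) T"
    and eq: "{x \<in> RN N. f x \<in> ball (f y) 1} = T \<inter> RN N"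
    by blast
  have "y \<in> {x \<in> RN N. f x \<in> ball (f y) 1}" using assms(2) by simp
  then have "y \<in> T" unfolding eq by (rule IntD1)
  then obtain U where U: "\<And>i. open (U i)" "y \<in> Pi\<^sub>E UNIV U" "Pi\<^sub>E UNIV U \<subseteq> T"
    using T unfolding openin_product_topology_alt by (simp add: Ball_def) metis
  have "\<exists>d. d > 0 \<and> ball (y i) d \<subseteq> U i" for i
    using U(1)[of i] U(2) by (meson PiE_mem UNIV_I openE)
  then obtain d where d: "\<And>i. d i > 0" "\<And>i. ball (y i) (d i) \<subseteq> U i" by metis
  \<comment> \<open>The \<open>1\<close> keeps the minimum positive when \<open>N = 0\<close>.\<close>
  define \<delta> where "\<delta> = Min (insert 1 (d ` {..<N}))"
  have "\<delta> > 0" unfolding \<delta>_def using d(1) by (subst Min_gr_iff) auto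
  moreover have "\<bar>f x\<bar> \<le> \<bar>f y\<bar> + 1" if x: "x \<in> RN N" "\<forall>i<N. \<bar>x i - y i\<bar> < \<delta>" for x
  proof -
    have "x i \<in> U i" for i
    proof (cases "i < N")
      case True
      have "\<delta> \<le> d i" unfolding \<delta>_def using True by (intro Min_le) auto
      then have "x i \<in> ball (y i) (d i)" using x(2) True by (force simp: dist_real_def)
      then show ?thesis using d(2)[of i] by (rule rev_subsetD)
    next
      case False
      then have "x i = y i" using x(1) assms(2) by (simp add: topspace_Euclidean_space)
      then show ?thesis using U(2) by auto
    qed
    then have "x \<in> T" using U(3) by auto
    then have "f x \<in> ball (f y) 1" using eq x(1) by blast
    then show ?thesis by (auto simp: dist_real_def)
  qed
  ultimately show ?thesis by blast
qed

text \<open>The Lagrange form without the case distinction on the side of \<open>c\<close>; it includes \<open>t = c\<close>.\<close>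

lemma Taylor_symmetric:
  fixes G :: "nat \<Rightarrow> real \<Rightarrow> real"
  assumes "m > 0" and "\<And>q t. q < m \<Longrightarrow> (G q has_real_derivative G (Suc q) t) (at t)"
  shows "\<exists>\<xi>. \<bar>\<xi> - c\<bar> \<le> \<bar>t - c\<bar> \<and>
    G 0 t = (\<Sum>q<m. G q c / fact q * (t - c) ^ q) + G m \<xi> / fact m * (t - c) ^ m"
proof (cases "t = c")
  case True
  have "(\<Sum>q<m. G q c / fact q * (0::real) ^ q) = (\<Sum>q\<in>{0}. G q c / fact q * 0 ^ q)"
    using assms(1) by (intro sum.mono_neutral_right) auto
  then show ?thesis using True assms(1) by (intro exI[of _ c]) auto
next
  case False
  obtain \<xi> where "if t < c then t < \<xi> \<and> \<xi> < c else c < \<xi> \<and> \<xi> < t"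
    "G 0 t = (\<Sum>q<m. G q c / fact q * (t - c) ^ q) + G m \<xi> / fact m * (t - c) ^ m"
    using Taylor[of m G "G 0" "min t c" "max t c" c t] assms False by auto
  then show ?thesis by (intro exI[of _ \<xi>]) (auto split: if_splits)
qed

text \<open>Taylor expansion by one coordinate at a time.  Freezing the coordinate \<open>n\<close> at \<open>y n\<close>, the expansion
  of one variable in this coordinate has as coefficients the iterated partial derivatives in direction
  \<open>n\<close> at a point that differs from \<open>y\<close> in the first \<open>n\<close> coordinates only; these derivatives
  are smooth, so the induction hypothesis expands them.  In this way all
  differentiation happens along coordinate lines, which is what \<^const>\<open>smooth_RN\<close> provides.\<close>

lemma smooth_RN_Taylor_coords:
  assumes "smooth_RN N f" "y \<in> RN N" "m > 0" "n \<le> N"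
  shows "\<exists>P C \<delta>. polyfun N P \<and> \<delta> > 0 \<and>
    (\<forall>x\<in>RN N. \<forall>r\<le>\<delta>. (\<forall>i<n. \<bar>x i - y i\<bar> \<le> r) \<longrightarrow> (\<forall>i\<ge>n. x i = y i) \<longrightarrow> 0 \<le> r \<longrightarrow>
       \<bar>f x - P (\<lambda>i. x i - y i)\<bar> \<le> C * r ^ m)"
  using assms
proof (induction n arbitrary: f)
  case 0
  have "x = y" if "\<forall>i. x i = y i" for x using that by auto
  then show ?case
    by (intro exI[of _ "\<lambda>_. f y"] exI[of _ 0] exI[of _ 1]) (auto intro: polyfun.const)
next
  case (Suc n)
  let ?D = "\<lambda>q. (partial_deriv n ^^ q) f"
  have sm: "smooth_RN N (?D q)" for q
    using smooth_RN_partial_deriv_funpow Suc.prems by simp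
  \<comment> \<open>A named predicate, so that the polynomials and constants for all \<open>q\<close> can be chosen at once.\<close>
  define good where "good = (\<lambda>q P C \<delta>. polyfun N P \<and> \<delta> > 0 \<and>
    (\<forall>x\<in>RN N. \<forall>r\<le>\<delta>. (\<forall>i<n. \<bar>x i - y i\<bar> \<le> r) \<longrightarrow> (\<forall>i\<ge>n. x i = y i) \<longrightarrow> 0 \<le> r \<longrightarrow>
       \<bar>?D q x - P (\<lambda>i. x i - y i)\<bar> \<le> C * r ^ m))"
  have "\<exists>P C \<delta>. good q P C \<delta>" for q
    unfolding good_def using Suc.IH[OF sm] Suc.prems by simp
  then obtain P C \<delta> where good: "\<And>q. good q (P q) (C q) (\<delta> q)"
    by metis
  have P: "polyfun N (P q)" and \<delta>: "\<delta> q > 0" for q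
    using good[of q] by (simp_all add: good_def)
  have bnd: "\<bar>?D q x - P q (\<lambda>i. x i - y i)\<bar> \<le> C q * r ^ m"
    if "x \<in> RN N" "r \<le> \<delta> q" "\<forall>i<n. \<bar>x i - y i\<bar> \<le> r" "\<forall>i\<ge>n. x i = y i" "0 \<le> r" for q x r
    using good[of q] that by (simp add: good_def)
  obtain B \<epsilon> where \<epsilon>: "\<epsilon> > 0"
    and B: "\<And>x. x \<in> RN N \<Longrightarrow> (\<forall>i<N. \<bar>x i - y i\<bar> < \<epsilon>) \<Longrightarrow> \<bar>?D m x\<bar> \<le> B"
    using smooth_RN_locally_bounded[OF sm Suc.prems(2)] by metis
  \<comment> \<open>Radius at most \<open>1\<close>, so that powers of the last coordinate do not spoil the bounds for the
    coefficients; half of \<open>\<epsilon>\<close>, because the remainder needs a strict inequality.\<close>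
  define \<delta>' where "\<delta>' = Min (insert 1 (insert (\<epsilon> / 2) (\<delta> ` {..<m})))"
  have \<delta>'_pos: "\<delta>' > 0" unfolding \<delta>'_def using \<delta> \<epsilon> by (subst Min_gr_iff) auto
  have \<delta>'_le: "\<delta>' \<le> 1" "\<delta>' < \<epsilon>" "\<And>q. q < m \<Longrightarrow> \<delta>' \<le> \<delta> q"
  proof -
    have "\<delta>' \<le> \<epsilon> / 2" unfolding \<delta>'_def by (intro Min_le) auto
    then show "\<delta>' < \<epsilon>" using \<epsilon> by linarith
  next
    fix q assume "q < m"
    then show "\<delta>' \<le> \<delta> q" unfolding \<delta>'_def by (intro Min_le) auto
  next
    show "\<delta>' \<le> 1" unfolding \<delta>'_def by (intro Min_le) auto
  qed
  define Q where "Q = (\<lambda>u. \<Sum>q<m. P q (u(n := 0)) * ((1 / fact q) * u n ^ q))"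
  have "polyfun N (\<lambda>u. P q (u(n := 0)) * ((1 / fact q) * u n ^ q))" for q
    using Suc.prems(4)
    by (intro polyfun.mult polyfun_fun_upd_zero[OF P] polyfun_power[OF polyfun.coord] polyfun.const) simp
  then have "polyfun N Q"
    unfolding Q_def by (rule polyfun_sum)
  moreover have "\<bar>f x - Q (\<lambda>i. x i - y i)\<bar> \<le> ((\<Sum>q<m. C q) + B) * r ^ m"
    if x: "x \<in> RN N" and r: "r \<le> \<delta>'" "0 \<le> r" and xr: "\<forall>i<Suc n. \<bar>x i - y i\<bar> \<le> r"
      and xy: "\<forall>i\<ge>Suc n. x i = y i" for x r
  proof -
    let ?x = "x(n := y n)" and ?t = "x n - y n"
    have x': "?x \<in> RN N" using x Suc.prems by (auto simp: topspace_Euclidean_space)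
    have "\<exists>\<xi>. \<bar>\<xi> - y n\<bar> \<le> \<bar>x n - y n\<bar> \<and>
      ?D 0 (x(n := x n)) = (\<Sum>q<m. ?D q ?x / fact q * ?t ^ q) + ?D m (x(n := \<xi>)) / fact m * ?t ^ m"
    proof (rule Taylor_symmetric[of m "\<lambda>q t. ?D q (x(n := t))" "y n" "x n"])
      show "((\<lambda>t. ?D q (x(n := t))) has_real_derivative ?D (Suc q) (x(n := t))) (at t)" for q t
        using smooth_RN_has_partial_deriv[OF sm, of n x q t] Suc.prems x by simp
    qed fact
    then obtain \<xi> where "\<bar>\<xi> - y n\<bar> \<le> \<bar>x n - y n\<bar>"
      and fx: "f x = (\<Sum>q<m. ?D q ?x / fact q * ?t ^ q) + ?D m (x(n := \<xi>)) / fact m * ?t ^ m"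
      by auto
    then have \<xi>: "\<bar>\<xi> - y n\<bar> \<le> r" using xr by (force intro: order_trans)
    have t: "\<bar>?t\<bar> \<le> r" using xr by auto
    have upd: "(\<lambda>i. x i - y i)(n := 0) = (\<lambda>i. ?x i - y i)" by auto
    have summand: "\<bar>?D q ?x / fact q * ?t ^ q - P q (\<lambda>i. ?x i - y i) * ((1 / fact q) * ?t ^ q)\<bar> \<le> C q * r ^ m"
      if q: "q < m" for q
    proof -
      have "\<bar>?t ^ q / fact q\<bar> \<le> 1"
      proof -
        have "\<bar>?t\<bar> ^ q \<le> 1" using t r \<delta>'_le(1) by (intro power_le_one) auto
        then have "\<bar>?t\<bar> ^ q \<le> fact q" using fact_ge_1[of q, where 'a = real] by linarith
        then show ?thesis by (simp add: power_abs)
      qed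
      moreover have "\<bar>?D q ?x - P q (\<lambda>i. ?x i - y i)\<bar> \<le> C q * r ^ m"
        by (rule bnd[OF x']) (use r \<delta>'_le(3)[OF q] xr xy in \<open>auto simp: not_less_eq_eq\<close>)
      ultimately have "\<bar>?D q ?x - P q (\<lambda>i. ?x i - y i)\<bar> * \<bar>?t ^ q / fact q\<bar> \<le> (C q * r ^ m) * 1"
        by (intro mult_mono) auto
      moreover have "?D q ?x / fact q * ?t ^ q - P q (\<lambda>i. ?x i - y i) * ((1 / fact q) * ?t ^ q)
          = (?D q ?x - P q (\<lambda>i. ?x i - y i)) * (?t ^ q / fact q)"
        by (simp only: left_diff_distrib times_divide_eq_left times_divide_eq_right mult_1 diff_divide_distrib)
      ultimately show ?thesis by (simp only: abs_mult mult_1_right)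
    qed
    have rem: "\<bar>?D m (x(n := \<xi>)) / fact m * ?t ^ m\<bar> \<le> B * r ^ m"
    proof -
      have "\<bar>?D m (x(n := \<xi>))\<bar> \<le> B"
      proof (rule B)
        show "x(n := \<xi>) \<in> RN N" using x Suc.prems by (auto simp: topspace_Euclidean_space)
        show "\<forall>i<N. \<bar>(x(n := \<xi>)) i - y i\<bar> < \<epsilon>"
        proof (intro allI impI)
          fix i
          have "\<bar>(x(n := \<xi>)) i - y i\<bar> \<le> r"
            using xr xy \<xi> r by (cases "i < n"; cases "i = n") (auto simp: not_less_eq_eq)
          then show "\<bar>(x(n := \<xi>)) i - y i\<bar> < \<epsilon>" using r \<delta>'_le by linarith
        qed
      qed
      moreover have "\<bar>?t\<bar> ^ m \<le> r ^ m" using t by (intro power_mono) auto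
      moreover have "\<bar>?D m (x(n := \<xi>))\<bar> / fact m \<le> \<bar>?D m (x(n := \<xi>))\<bar>"
        using divide_left_mono[of 1 "fact m" "\<bar>?D m (x(n := \<xi>))\<bar>"] by (simp add: fact_ge_1)
      ultimately have "\<bar>?D m (x(n := \<xi>))\<bar> / fact m * \<bar>?t\<bar> ^ m \<le> B * r ^ m"
        by (intro mult_mono) auto
      then show ?thesis by (simp add: abs_mult power_abs)
    qed
    have "f x - Q (\<lambda>i. x i - y i) =
        (\<Sum>q<m. ?D q ?x / fact q * ?t ^ q - P q (\<lambda>i. ?x i - y i) * ((1 / fact q) * ?t ^ q))
        + ?D m (x(n := \<xi>)) / fact m * ?t ^ m"
      unfolding Q_def upd fx by (simp add: sum_subtractf)
    moreover have "\<bar>\<Sum>q<m. ?D q ?x / fact q * ?t ^ q - P q (\<lambda>i. ?x i - y i) * ((1 / fact q) * ?t ^ q)\<bar>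
        \<le> (\<Sum>q<m. C q * r ^ m)"
      by (rule order_trans[OF sum_abs sum_mono]) (simp only: summand lessThan_iff)
    ultimately have "\<bar>f x - Q (\<lambda>i. x i - y i)\<bar> \<le> (\<Sum>q<m. C q * r ^ m) + B * r ^ m"
      using rem by linarith
    then show ?thesis by (simp add: sum_distrib_right distrib_right)
  qed
  ultimately show ?case using \<delta>'_pos by blast
qed

lemma smooth_RN_Taylor:
  assumes "smooth_RN N f" "y \<in> RN N" "m > 0"
  shows "\<exists>P C \<delta>. polyfun N P \<and> \<delta> > 0 \<and>
    (\<forall>x\<in>RN N. \<forall>r\<le>\<delta>. (\<forall>i<N. \<bar>x i - y i\<bar> \<le> r) \<longrightarrow> 0 \<le> r \<longrightarrow>
       \<bar>f x - P (\<lambda>i. x i - y i)\<bar> \<le> C * r ^ m)"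
proof -
  have "x i = y i" if "x \<in> RN N" "i \<ge> N" for x i
    using that assms(2) by (simp add: topspace_Euclidean_space)
  then show ?thesis
    using smooth_RN_Taylor_coords[OF assms order_refl] by (simp cong: conj_cong ball_cong)
qed

section \<open>Trees and their weights\<close>

text \<open>The trees that occur as complete subtrees of members of \<^const>\<open>LW3\<close>: they may have a square root.\<close>

definition LW3_sub :: "tree set" where
  "LW3_sub = {\<tau>. \<forall>\<sigma>\<in>subtrees \<tau>.
     (root \<sigma> = Fat \<longrightarrow> size (children \<sigma>) \<le> 1) \<and>
     (root \<sigma> = Square \<longrightarrow> (\<exists>\<sigma>'. children \<sigma> = {#\<sigma>'#} \<and> root \<sigma>' \<in> {Square, Fat}))}"

lemma LW3_iff: "\<tau> \<in> LW3 \<longleftrightarrow> \<tau> \<in> LW3_sub \<and> root \<tau> \<noteq> Square"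
  by (auto simp: LW3_def LW3_sub_def)

lemma subtrees_refl: "\<tau> \<in> subtrees \<tau>"
  by (cases \<tau>) simp

lemma subtrees_trans: "\<rho> \<in> subtrees \<sigma> \<Longrightarrow> \<sigma> \<in> subtrees \<tau> \<Longrightarrow> \<rho> \<in> subtrees \<tau>"
  by (induction \<tau>) auto

lemma finite_subtrees: "finite (subtrees \<tau>)"
  by (induction \<tau>) auto

lemma LW3_sub_subtree: "\<tau> \<in> LW3_sub \<Longrightarrow> \<sigma> \<in> subtrees \<tau> \<Longrightarrow> \<sigma> \<in> LW3_sub"
  unfolding LW3_sub_def using subtrees_trans by blast

lemma LW3_sub_Meagre: "Node Meagre ts \<in> LW3_sub \<longleftrightarrow> set_mset ts \<subseteq> LW3_sub"
  by (auto simp: LW3_sub_def)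

lemma LW3_sub_Fat: "Node Fat ts \<in> LW3_sub \<longleftrightarrow> size ts \<le> 1 \<and> set_mset ts \<subseteq> LW3_sub"
  by (auto simp: LW3_sub_def)

lemma LW3_sub_Square:
  "Node Square ts \<in> LW3_sub \<longleftrightarrow>
    (\<exists>\<sigma>. ts = {#\<sigma>#} \<and> root \<sigma> \<in> {Square, Fat} \<and> \<sigma> \<in> LW3_sub)"
  by (auto simp: LW3_sub_def)

lemma theta_simps [simp]:
  "theta 0 ts = Node Fat ts" "theta (Suc q) ts = Node Square {#theta q ts#}"
  by (simp_all add: theta_def)

lemma root_theta: "root (theta q ts) = (if q = 0 then Fat else Square)"
  by (cases q) simp_all

lemma theta_in_LW3_sub: "theta q ts \<in> LW3_sub \<longleftrightarrow> size ts \<le> 1 \<and> set_mset ts \<subseteq> LW3_sub"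
  by (induction q) (auto simp: LW3_sub_Fat LW3_sub_Square root_theta)

lemma tree_order_theta: "tree_order (theta q ts) = Suc q + (\<Sum>\<tau>\<in>#ts. tree_order \<tau>)"
  by (induction q) simp_all

lemma subtrees_theta: "\<tau> \<in># ts \<Longrightarrow> subtrees \<tau> \<subseteq> subtrees (theta q ts)"
  by (induction q) auto

text \<open>A square vertex has a single child that is square or fat, so squares form chains that end in a fat vertex.\<close>

lemma LW3_sub_non_Meagre_theta:
  assumes "\<tau> \<in> LW3_sub" "root \<tau> \<noteq> Meagre"
  shows "\<exists>q ts. \<tau> = theta q ts"
  using assms
proof (induction \<tau>)
  case (Node c ts)
  show ?case
  proof (cases c)
    case Fat
    then show ?thesis by (metis theta_simps(1))
  next
    case Square
    then obtain \<sigma> where \<sigma>: "ts = {#\<sigma>#}" "root \<sigma> \<in> {Square, Fat}" "\<sigma> \<in> LW3_sub"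
      using Node.prems by (auto simp: LW3_sub_Square)
    then obtain q us where "\<sigma> = theta q us" using Node.IH[of \<sigma>] by auto
    then show ?thesis using Square \<sigma> by (metis theta_simps(2))
  qed (use Node.prems in auto)
qed

text \<open>The recursion mirrors integration: the derivative of \<open>t\<^bsup>\<rho>(\<tau>)\<^esup> exact_weight \<tau>\<close> is the
  product of the corresponding functions of the children if the root is meagre.\<close>

primrec exact_weight :: "tree \<Rightarrow> real" where
  "exact_weight (Node c ts) = (if c = Meagre
     then prod_mset (image_mset exact_weight ts) / real (tree_order (Node c ts)) else 0)"

lemma prod_mset_inverse: "(\<Prod>x\<in>#M. 1 / real (f x)) = 1 / real (\<Prod>x\<in>#M. f x)"
  by (induction M) simp_all

lemma exact_weight_eq:
  "exact_weight \<tau> = (if \<forall>\<sigma>\<in>subtrees \<tau>. root \<sigma> = Meagre then 1 / real (tree_density \<tau>) else 0)"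
proof (induction \<tau>)
  case (Node c ts)
  show ?case
  proof (cases "c = Meagre \<and> (\<forall>\<tau>\<in>#ts. \<forall>\<sigma>\<in>subtrees \<tau>. root \<sigma> = Meagre)")
    case True
    then have "image_mset exact_weight ts = (image_mset (\<lambda>\<tau>. 1 / real (tree_density \<tau>)) ts)"
      using Node by (intro image_mset_cong) auto
    then show ?thesis using True by (simp add: prod_mset_inverse algebra_simps)
  next
    case False
    have "exact_weight \<tau> = 0" if "\<tau> \<in># ts" "\<not> (\<forall>\<sigma>\<in>subtrees \<tau>. root \<sigma> = Meagre)" for \<tau>
      using Node[OF that(1)] that(2) by simp
    with False have "c \<noteq> Meagre \<or> (\<exists>\<tau>\<in>#ts. exact_weight \<tau> = 0)" by blast
    then have "exact_weight (Node c ts) = 0"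
      by (auto simp: prod_mset_zero_iff image_iff)
    then show ?thesis using False by auto
  qed
qed

text \<open>Together the two cases are the right-hand sides of the order conditions.\<close>

lemma exact_weight_LW3:
  "\<tau> \<in> LW3 \<Longrightarrow> exact_weight \<tau> = (if \<tau> \<in> meagre_trees then 1 / real (tree_density \<tau>) else 0)"
  by (simp add: exact_weight_eq meagre_trees_def)

lemma exact_weight_theta: "exact_weight (theta q ts) = 0"
  by (cases q) simp_all


section \<open>Expansions with common coefficients\<close>

lemma bigo_power_mono:
  assumes "n \<le> m"
  shows "(\<lambda>h::real. h ^ m) \<in> O[at 0](\<lambda>h. h ^ n)"
proof (rule bigoI[of _ 1])
  show "\<forall>\<^sub>F h::real in at 0. norm (h ^ m) \<le> 1 * norm (h ^ n)"
    unfolding eventually_at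
    by (intro exI[of _ 1]) (auto simp: power_abs dist_real_def assms intro!: power_decreasing)
qed

lemma bigo_mono_power:
  "n \<le> m \<Longrightarrow> f \<in> O[at 0](\<lambda>h::real. h ^ m) \<Longrightarrow> f \<in> O[at 0](\<lambda>h. h ^ n)"
  using bigo_power_mono landau_o.big_trans by blast

locale lirkw =
  fixes s :: nat and a gam :: "nat \<Rightarrow> nat \<Rightarrow> real"
begin

text \<open>Stages are numbered from \<open>1\<close>, which leaves the index \<open>0\<close> for the exact solution.\<close>

definition weight :: "nat \<Rightarrow> tree \<Rightarrow> real" where
  "weight i \<tau> = (if i = 0 then exact_weight \<tau> else Phi_bar s a gam \<tau> i)"

definition forest_term :: "tree multiset \<Rightarrow> nat \<Rightarrow> real \<Rightarrow> real" where
  "forest_term ts i h = (\<Prod>\<tau>\<in>#ts. h ^ tree_order \<tau> * weight i \<tau>)"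

text \<open>A combination is a family over all indices at once: this is how the exact solution and the stages are made to
  share their coefficients.\<close>

inductive combination :: "tree multiset set \<Rightarrow> (nat \<Rightarrow> real \<Rightarrow> real) \<Rightarrow> bool" for S where
  zero: "combination S (\<lambda>i h. 0)"
| add: "ts \<in> S \<Longrightarrow> combination S f \<Longrightarrow> combination S (\<lambda>i h. c * forest_term ts i h + f i h)"

definition expands :: "tree multiset set \<Rightarrow> nat \<Rightarrow> (nat \<Rightarrow> real \<Rightarrow> real) \<Rightarrow> bool" where
  "expands S m f \<longleftrightarrow>
     (\<exists>t. combination S t \<and> (\<forall>i\<le>s. (\<lambda>h. f i h - t i h) \<in> O[at 0](\<lambda>h. h ^ m)))"

definition forests :: "tree multiset set" where
  "forests = {ts. set_mset ts \<subseteq> LW3_sub}"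

definition single_trees :: "tree multiset set" where
  "single_trees = {{#\<tau>#} | \<tau>. \<tau> \<in> LW3_sub}"

lemma forest_term_empty [simp]: "forest_term {#} i h = 1"
  by (simp add: forest_term_def)

lemma forest_term_union: "forest_term (ts + us) i h = forest_term ts i h * forest_term us i h"
  by (simp add: forest_term_def)

lemma forest_term_eq:
  "forest_term ts i h = h ^ (\<Sum>\<tau>\<in>#ts. tree_order \<tau>) * (\<Prod>\<tau>\<in>#ts. weight i \<tau>)"
  by (induction ts) (simp_all add: forest_term_def power_add mult_ac)

lemma forests_union: "ts \<in> forests \<Longrightarrow> us \<in> forests \<Longrightarrow> ts + us \<in> forests"
  by (simp add: forests_def)

lemma single_trees_subset_forests: "single_trees \<subseteq> forests"
  by (auto simp: single_trees_def forests_def)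

lemma combination_term: "ts \<in> S \<Longrightarrow> combination S (\<lambda>i h. c * forest_term ts i h)"
  using combination.add[OF _ combination.zero, of ts S c] by simp

lemma combination_mono: "combination S f \<Longrightarrow> S \<subseteq> S' \<Longrightarrow> combination S' f"
  by (induction rule: combination.induct) (auto intro: combination.intros)

lemma combination_add:
  "combination S f \<Longrightarrow> combination S g \<Longrightarrow> combination S (\<lambda>i h. f i h + g i h)"
  by (induction rule: combination.induct)
     (auto simp: add.assoc intro: combination.intros)

lemma combination_scale: "combination S f \<Longrightarrow> combination S (\<lambda>i h. c * f i h)"
proof (induction rule: combination.induct)
  case (add ts f d)
  show ?case using combination.add[OF add(1,3), of "c * d"] by (simp add: algebra_simps)
qed (auto intro: combination.zero)

text \<open>The product of the terms of two forests is the term of their union, for every index.\<close>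

lemma combination_mult:
  assumes "combination forests f" "combination forests g"
  shows "combination forests (\<lambda>i h. f i h * g i h)"
  using assms(1)
proof induction
  case (add ts f c)
  have *: "combination forests (\<lambda>i h. forest_term ts i h * g i h)"
    using assms(2)
  proof induction
    case (add us g d)
    show ?case
      using combination.add[OF forests_union[OF \<open>ts \<in> forests\<close> add(1)] add(3), of d]
      by (simp add: forest_term_union algebra_simps)
  qed (auto intro: combination.zero)
  show ?case
    using combination_add[OF combination_scale[OF *, of c] add(3)] by (simp add: algebra_simps)
qed (auto intro: combination.zero)

lemma combination_bounded: "combination S f \<Longrightarrow> f i \<in> O[at 0](\<lambda>h. 1)"
proof (induction rule: combination.induct)
  case (add ts f c)
  have "(\<lambda>h. h ^ (\<Sum>\<tau>\<in>#ts. tree_order \<tau>)) \<in> O[at 0](\<lambda>h::real. h ^ 0)"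
    by (rule bigo_power_mono) simp
  then have "(\<lambda>h. c * forest_term ts i h) \<in> O[at 0](\<lambda>h. 1)"
    unfolding forest_term_eq by (cases "c = 0 \<or> (\<Prod>\<tau>\<in>#ts. weight i \<tau>) = 0") (auto simp: mult_ac)
  then show ?case using add(3) by (rule sum_in_bigo)
qed auto

lemma expands_combination: "combination S f \<Longrightarrow> expands S m f"
  unfolding expands_def by (intro exI[of _ f]) simp

lemma expands_cong:
  assumes "\<And>i. i \<le> s \<Longrightarrow> (\<lambda>h. f i h - g i h) \<in> O[at 0](\<lambda>h. h ^ m)" "expands S m g"
  shows "expands S m f"
proof -
  obtain t where t: "combination S t" "\<And>i. i \<le> s \<Longrightarrow> (\<lambda>h. g i h - t i h) \<in> O[at 0](\<lambda>h. h ^ m)"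
    using assms(2) unfolding expands_def by blast
  have "(\<lambda>h. f i h - t i h) \<in> O[at 0](\<lambda>h. h ^ m)" if "i \<le> s" for i
    using sum_in_bigo(1)[OF assms(1)[OF that] t(2)[OF that]] by simp
  then show ?thesis unfolding expands_def using t(1) by blast
qed

lemma expands_subset: "expands S m f \<Longrightarrow> S \<subseteq> S' \<Longrightarrow> expands S' m f"
  unfolding expands_def using combination_mono by blast

lemma expands_add:
  assumes "expands S m f" "expands S m g"
  shows "expands S m (\<lambda>i h. f i h + g i h)"
proof -
  obtain t u where t: "combination S t" "\<And>i. i \<le> s \<Longrightarrow> (\<lambda>h. f i h - t i h) \<in> O[at 0](\<lambda>h. h ^ m)"
    and u: "combination S u" "\<And>i. i \<le> s \<Longrightarrow> (\<lambda>h. g i h - u i h) \<in> O[at 0](\<lambda>h. h ^ m)"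
    using assms unfolding expands_def by blast
  have "(\<lambda>h. (f i h + g i h) - (t i h + u i h)) \<in> O[at 0](\<lambda>h. h ^ m)" if "i \<le> s" for i
    using sum_in_bigo(1)[OF t(2)[OF that] u(2)[OF that]] by (simp add: algebra_simps)
  then show ?thesis
    unfolding expands_def using combination_add[OF t(1) u(1)] by blast
qed

lemma expands_sum:
  "(\<And>k. k \<in> K \<Longrightarrow> expands S m (f k)) \<Longrightarrow> expands S m (\<lambda>i h. \<Sum>k\<in>K. f k i h)"
  by (induction K rule: infinite_finite_induct)
     (auto intro: expands_add expands_combination combination.zero)

lemma expands_bounded:
  assumes "expands S m f" "i \<le> s"
  shows "f i \<in> O[at 0](\<lambda>h. 1)"
proof -
  obtain t where t: "combination S t" "(\<lambda>h. f i h - t i h) \<in> O[at 0](\<lambda>h. h ^ m)"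
    using assms unfolding expands_def by blast
  have "(\<lambda>h. f i h - t i h) \<in> O[at 0](\<lambda>h. h ^ 0)"
    using t(2) by (rule bigo_mono_power[rotated]) simp
  then have "(\<lambda>h. (f i h - t i h) + t i h) \<in> O[at 0](\<lambda>h. 1)"
    by (intro sum_in_bigo(1) combination_bounded[OF t(1)]) simp
  then show ?thesis by simp
qed

text \<open>From \<open>f g - t u = (f - t) g + t (g - u)\<close>, where \<open>g\<close> and \<open>t\<close> are bounded.\<close>

lemma expands_mult:
  assumes "expands forests m f" "expands forests m g"
  shows "expands forests m (\<lambda>i h. f i h * g i h)"
proof -
  obtain t u where t: "combination forests t" "\<And>i. i \<le> s \<Longrightarrow> (\<lambda>h. f i h - t i h) \<in> O[at 0](\<lambda>h. h ^ m)"
    and u: "combination forests u" "\<And>i. i \<le> s \<Longrightarrow> (\<lambda>h. g i h - u i h) \<in> O[at 0](\<lambda>h. h ^ m)"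
    using assms unfolding expands_def by blast
  have "(\<lambda>h. f i h * g i h - t i h * u i h) \<in> O[at 0](\<lambda>h. h ^ m)" if "i \<le> s" for i
  proof -
    have "(\<lambda>h. (f i h - t i h) * g i h) \<in> O[at 0](\<lambda>h. h ^ m * 1)"
      by (intro landau_o.big.mult t(2) expands_bounded[OF assms(2)] that)
    moreover have "(\<lambda>h. t i h * (g i h - u i h)) \<in> O[at 0](\<lambda>h. 1 * h ^ m)"
      by (intro landau_o.big.mult u(2) combination_bounded[OF t(1)] that)
    ultimately have "(\<lambda>h. (f i h - t i h) * g i h + t i h * (g i h - u i h)) \<in> O[at 0](\<lambda>h. h ^ m)"
      by (intro sum_in_bigo(1)) simp_all
    then show ?thesis by (simp add: algebra_simps)
  qed
  then show ?thesis
    unfolding expands_def using combination_mult[OF t(1) u(1)] by blast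
qed

lemma expands_const: "{#} \<in> S \<Longrightarrow> expands S m (\<lambda>i h. c)"
  using expands_combination[OF combination_term[of "{#}" S c]] by simp

lemma empty_forest: "{#} \<in> forests"
  by (simp add: forests_def)

text \<open>The empty forest accounts for the constant \<open>y\<^sub>n\<close>; grafting it creates a leaf.\<close>

lemma expands_shift:
  assumes "expands single_trees m (\<lambda>i h. f i h - c)"
  shows "expands (insert {#} single_trees) m f"
proof -
  have "expands (insert {#} single_trees) m (\<lambda>i h. c + (f i h - c))"
    by (intro expands_add expands_const expands_subset[OF assms]) auto
  then show ?thesis by simp
qed

lemma expands_polyfun:
  assumes "polyfun N P" "\<And>\<nu>. \<nu> < N \<Longrightarrow> expands single_trees m (\<lambda>i h. U i h \<nu>)"
  shows "expands forests m (\<lambda>i h. P (U i h))"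
  using assms(1)
proof induction
  case (coord \<nu>)
  then show ?case using assms(2) expands_subset single_trees_subset_forests by blast
qed (auto intro: expands_const expands_add expands_mult empty_forest)


text \<open>The lemmas on \<open>forest_term\<close> that follow describe how a step of the method or an integration grafts a
  forest onto a new root.  They serve both directions of the theorem.\<close>

lemma forest_term_Meagre:
  assumes "i \<in> {1..s}"
  shows "forest_term {#Node Meagre ts#} i h = h * (\<Sum>j=1..s. a i j * forest_term ts j h)"
proof -
  have "forest_term ts j h = h ^ (\<Sum>\<tau>\<in>#ts. tree_order \<tau>) * (\<Prod>\<tau>\<in>#ts. Phi_bar s a gam \<tau> j)"
    if "j \<in> {1..s}" for j
    using that by (simp add: forest_term_eq weight_def[abs_def])
  then have "(\<Sum>j=1..s. a i j * forest_term ts j h)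
      = h ^ (\<Sum>\<tau>\<in>#ts. tree_order \<tau>) * (\<Sum>j=1..s. a i j * (\<Prod>\<tau>\<in>#ts. Phi_bar s a gam \<tau> j))"
    unfolding sum_distrib_left by (intro sum.cong) (auto simp: mult_ac)
  also have "(\<Sum>j=1..s. a i j * (\<Prod>\<tau>\<in>#ts. Phi_bar s a gam \<tau> j)) = weight i (Node Meagre ts)"
    using assms by (simp add: weight_def multiset.map_comp comp_def)
  finally show ?thesis by (simp add: forest_term_def mult_ac)
qed

lemma forest_term_theta:
  assumes "i \<in> {1..s}" "size ts \<le> 1"
  shows "forest_term {#theta q ts#} i h
    = h * (h * gam i i) ^ q * (\<Sum>j=1..s. gam i j * forest_term ts j h)"
proof -
  consider "ts = {#}" | \<tau> where "ts = {#\<tau>#}"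
    using assms(2) by (metis One_nat_def le_Suc_eq le_zero_eq size_1_singleton_mset size_eq_0_iff_empty)
  then show ?thesis
  proof cases
    case 1
    then show ?thesis using assms(1)
      by (simp add: forest_term_def weight_def Phi_bar_theta tree_order_theta power_mult_distrib
          sum_distrib_left mult_ac)
  next
    case 2
    then show ?thesis using assms(1)
      by (simp add: forest_term_def weight_def Phi_bar_theta tree_order_theta power_mult_distrib
          power_add sum_distrib_left mult_ac)
  qed
qed

lemma forest_term_Meagre_exact:
  "(forest_term {#Node Meagre ts#} 0 has_real_derivative forest_term ts 0 h) (at h)"
proof -
  let ?\<tau> = "Node Meagre ts"
  have ft: "forest_term {#?\<tau>#} 0 = (\<lambda>h. h ^ tree_order ?\<tau> * ((\<Prod>\<tau>\<in>#ts. weight 0 \<tau>) / real (tree_order ?\<tau>)))"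
    by (auto simp: forest_term_def weight_def fun_eq_iff)
  have "((\<lambda>h. h ^ Suc n * (w / real (Suc n))) has_real_derivative h ^ n * w) (at h)" for n w and h :: real
    by (rule derivative_eq_intros refl)+ (simp del: of_nat_Suc)
  from this[of "\<Sum>\<tau>\<in>#ts. tree_order \<tau>" "\<Prod>\<tau>\<in>#ts. weight 0 \<tau>"]
  show ?thesis unfolding ft forest_term_eq by simp
qed

lemma forest_term_Meagre_exact_0: "forest_term {#Node Meagre ts#} 0 0 = 0"
  by (simp add: forest_term_def)

lemma forest_term_theta_exact: "forest_term {#theta q ts#} 0 h = 0"
  by (simp add: forest_term_def weight_def exact_weight_theta)

text \<open>One combination \<open>T\<close> represents both operations, since grafting onto a meagre root does the same to the
  weights of the stages as \<open>h \<Sum>\<^sub>j a\<^sub>i\<^sub>j\<close>, and to the exact weights as integration from \<open>0\<close>.\<close>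

lemma combination_graft_Meagre:
  assumes "combination forests t"
  shows "\<exists>T. combination single_trees T \<and>
    (\<forall>i\<in>{1..s}. \<forall>h. T i h = h * (\<Sum>j=1..s. a i j * t j h)) \<and>
    (\<forall>h. (T 0 has_real_derivative t 0 h) (at h)) \<and> T 0 0 = 0"
  using assms
proof induction
  case zero
  show ?case by (intro exI[of _ "\<lambda>i h. 0"]) (auto intro: combination.zero)
next
  case (add ts f c)
  then obtain T where T: "combination single_trees T"
    "\<And>i h. i \<in> {1..s} \<Longrightarrow> T i h = h * (\<Sum>j=1..s. a i j * f j h)"
    "\<And>h. (T 0 has_real_derivative f 0 h) (at h)" "T 0 0 = 0"
    by blast
  let ?\<tau> = "Node Meagre ts"
  let ?G = "\<lambda>i h. c * forest_term {#?\<tau>#} i h + T i h"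
  have "{#?\<tau>#} \<in> single_trees"
    using add(1) by (auto simp: single_trees_def forests_def LW3_sub_Meagre)
  then have 1: "combination single_trees ?G" using T(1) by (rule combination.add)
  have 2: "?G i h = h * (\<Sum>j=1..s. a i j * (c * forest_term ts j h + f j h))"
    if i: "i \<in> {1..s}" for i h
    unfolding T(2)[OF i] forest_term_Meagre[OF i] by (simp add: algebra_simps sum.distrib sum_distrib_left)
  from DERIV_add[OF DERIV_cmult[OF forest_term_Meagre_exact] T(3)]
  have 3: "(?G 0 has_real_derivative c * forest_term ts 0 h + f 0 h) (at h)" for h .
  have 4: "?G 0 0 = 0" using T(4) by (simp add: forest_term_Meagre_exact_0)
  show ?case by (intro exI[of _ ?G]) (use 1 2 3 4 in blast)
qed

lemma combination_graft_theta:
  assumes "combination (insert {#} single_trees) t"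
  shows "\<exists>T. combination single_trees T \<and>
    (\<forall>i\<in>{1..s}. \<forall>h. T i h = h * (h * gam i i) ^ q * (\<Sum>j=1..s. gam i j * t j h)) \<and>
    (\<forall>h. T 0 h = 0)"
  using assms
proof induction
  case zero
  show ?case by (intro exI[of _ "\<lambda>i h. 0"]) (auto intro: combination.zero)
next
  case (add ts f c)
  then obtain T where T: "combination single_trees T"
    "\<And>i h. i \<in> {1..s} \<Longrightarrow> T i h = h * (h * gam i i) ^ q * (\<Sum>j=1..s. gam i j * f j h)"
    "\<And>h. T 0 h = 0"
    by blast
  let ?\<tau> = "theta q ts"
  let ?G = "\<lambda>i h. c * forest_term {#?\<tau>#} i h + T i h"
  have "{#?\<tau>#} \<in> single_trees" and ts: "size ts \<le> 1"
    using add(1) by (auto simp: single_trees_def theta_in_LW3_sub)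
  then have 1: "combination single_trees ?G" using T(1) by (intro combination.add)
  have 2: "?G i h = h * (h * gam i i) ^ q * (\<Sum>j=1..s. gam i j * (c * forest_term ts j h + f j h))"
    if i: "i \<in> {1..s}" for i h
    unfolding T(2)[OF i] forest_term_theta[OF i ts]
    by (simp add: algebra_simps sum.distrib sum_distrib_left)
  have 3: "?G 0 h = 0" for h using T(3) by (simp add: forest_term_theta_exact)
  show ?case by (intro exI[of _ ?G]) (use 1 2 3 in blast)
qed

lemma forest_term_result_Meagre:
  "h * (\<Sum>j=1..s. b j * forest_term ts j h)
    = h ^ tree_order (Node Meagre ts) * (\<Sum>j=1..s. Phi s a gam b g (Node Meagre ts) j)"
proof -
  have "h * (b j * forest_term ts j h)
      = h ^ tree_order (Node Meagre ts) * Phi s a gam b g (Node Meagre ts) j" if "j \<in> {1..s}" for j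
    using that by (simp add: forest_term_eq weight_def[abs_def] mult_ac)
  then show ?thesis unfolding sum_distrib_left by (intro sum.cong refl)
qed

lemma forest_term_result_Fat:
  "h * (\<Sum>j=1..s. g j * forest_term ts j h)
    = h ^ tree_order (Node Fat ts) * (\<Sum>j=1..s. Phi s a gam b g (Node Fat ts) j)"
proof -
  have "h * (g j * forest_term ts j h)
      = h ^ tree_order (Node Fat ts) * Phi s a gam b g (Node Fat ts) j" if "j \<in> {1..s}" for j
    using that by (simp add: forest_term_eq weight_def[abs_def] mult_ac)
  then show ?thesis unfolding sum_distrib_left by (intro sum.cong refl)
qed

end

section \<open>Asymptotic estimates and grafting\<close>

lemma bigo_eventually_zero:
  "\<forall>\<^sub>F h in F. f h = (0::real) \<Longrightarrow> f \<in> O[F](g)"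
  by (rule bigoI[of _ 0]) (auto elim: eventually_mono)

text \<open>By the mean value theorem \<open>D h = h * d \<xi>\<close> with \<open>0 < \<bar>\<xi>\<bar> < \<bar>h\<bar>\<close>; the bound on \<open>d\<close>
  says nothing at \<open>0\<close> itself, so it matters that \<open>\<xi>\<close> is not \<open>0\<close>.\<close>

lemma bigo_integrate:
  fixes D d :: "real \<Rightarrow> real"
  assumes "\<forall>\<^sub>F h in nhds 0. (D has_real_derivative d h) (at h)" "D 0 = 0"
    and "d \<in> O[at 0](\<lambda>h. h ^ m)"
  shows "D \<in> O[at 0](\<lambda>h. h ^ Suc m)"
proof -
  obtain C where "C > 0" "\<forall>\<^sub>F h in at 0. norm (d h) \<le> C * norm (h ^ m)"
    using assms(3) by (elim landau_o.bigE)
  then obtain \<epsilon> where \<epsilon>: "\<epsilon> > 0" "\<And>h. h \<noteq> 0 \<Longrightarrow> \<bar>h\<bar> < \<epsilon> \<Longrightarrow> \<bar>d h\<bar> \<le> C * \<bar>h\<bar> ^ m"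
    by (auto simp: eventually_at dist_real_def power_abs)
  obtain \<epsilon>' where \<epsilon>': "\<epsilon>' > 0" "\<And>h. \<bar>h\<bar> < \<epsilon>' \<Longrightarrow> (D has_real_derivative d h) (at h)"
    using assms(1) by (auto simp: eventually_nhds_metric dist_real_def)
  have "\<bar>D h\<bar> \<le> C * \<bar>h\<bar> ^ Suc m" if h: "h \<noteq> 0" "\<bar>h\<bar> < min \<epsilon> \<epsilon>'" for h
  proof -
    have "\<exists>\<xi>. \<xi> \<noteq> 0 \<and> \<bar>\<xi>\<bar> \<le> \<bar>h\<bar> \<and> D h = h * d \<xi>"
    proof (cases "h > 0")
      case True
      then obtain \<xi> where "0 < \<xi>" "\<xi> < h" "D h - D 0 = (h - 0) * d \<xi>"
        using MVT2[of 0 h D d] \<epsilon>'(2) h by auto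
      then show ?thesis using assms(2) by (intro exI[of _ \<xi>]) auto
    next
      case False
      then obtain \<xi> where "h < \<xi>" "\<xi> < 0" "D 0 - D h = (0 - h) * d \<xi>"
        using MVT2[of h 0 D d] \<epsilon>'(2) h by auto
      then show ?thesis using assms(2) by (intro exI[of _ \<xi>]) auto
    qed
    then obtain \<xi> where \<xi>: "\<xi> \<noteq> 0" "\<bar>\<xi>\<bar> \<le> \<bar>h\<bar>" "D h = h * d \<xi>" by blast
    have "\<bar>d \<xi>\<bar> \<le> C * \<bar>\<xi>\<bar> ^ m" using \<epsilon>(2)[OF \<xi>(1)] \<xi>(2) h(2) by simp
    also have "\<dots> \<le> C * \<bar>h\<bar> ^ m" using \<xi>(2) \<open>C > 0\<close> by (intro mult_left_mono power_mono) auto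
    finally have "\<bar>h\<bar> * \<bar>d \<xi>\<bar> \<le> \<bar>h\<bar> * (C * \<bar>h\<bar> ^ m)" by (intro mult_left_mono) auto
    then show ?thesis using \<xi>(3) by (simp add: abs_mult mult_ac)
  qed
  then show ?thesis
    using \<epsilon>(1) \<epsilon>'(1)
    by (intro bigoI[of _ C]) (auto simp: eventually_at dist_real_def power_abs abs_mult intro!: exI[of _ "min \<epsilon> \<epsilon>'"])
qed

lemma bigo_id_mult:
  "f \<in> O[at 0](\<lambda>h. h ^ m) \<Longrightarrow> (\<lambda>h::real. h * f h) \<in> O[at 0](\<lambda>h. h ^ Suc m)"
  using landau_o.big.mult[of "\<lambda>h::real. h" "at 0" "\<lambda>h. h" f "\<lambda>h. h ^ m"] by simp

lemma Taylor_bigo: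
  fixes G :: "nat \<Rightarrow> real \<Rightarrow> real"
  assumes G: "\<And>q t. (G q has_real_derivative G (Suc q) t) (at t)" and "m > 0"
  shows "(\<lambda>h. G 0 (tn + h * c) - (\<Sum>q<m. G q tn / fact q * (h * c) ^ q)) \<in> O[at 0](\<lambda>h. h ^ m)"
proof -
  have "isCont (G m) tn" using G DERIV_isCont by blast
  then obtain \<delta> where \<delta>: "\<delta> > 0" "\<And>x. \<bar>x - tn\<bar> < \<delta> \<Longrightarrow> \<bar>G m x - G m tn\<bar> < 1"
    unfolding continuous_at_eps_delta by (metis dist_real_def zero_less_one)
  let ?B = "(\<bar>G m tn\<bar> + 1) / fact m * \<bar>c\<bar> ^ m"
  have *: "\<bar>G 0 (tn + h * c) - (\<Sum>q<m. G q tn / fact q * (h * c) ^ q)\<bar> \<le> ?B * \<bar>h\<bar> ^ m"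
    if h: "\<bar>h\<bar> < \<delta> / (\<bar>c\<bar> + 1)" for h
  proof -
    obtain \<xi> where \<xi>: "\<bar>\<xi> - tn\<bar> \<le> \<bar>h * c\<bar>"
      "G 0 (tn + h * c) = (\<Sum>q<m. G q tn / fact q * (h * c) ^ q) + G m \<xi> / fact m * (h * c) ^ m"
      using Taylor_symmetric[of m G tn "tn + h * c", OF assms(2) G] by auto
    have "\<bar>h * c\<bar> \<le> \<bar>h\<bar> * (\<bar>c\<bar> + 1)" by (simp add: abs_mult distrib_left)
    also have "\<dots> < \<delta>" using h by (simp add: pos_less_divide_eq)
    finally have "\<bar>\<xi> - tn\<bar> < \<delta>" using \<xi>(1) by linarith
    then have "\<bar>G m \<xi>\<bar> \<le> \<bar>G m tn\<bar> + 1" using \<delta>(2)[of \<xi>] by linarith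
    then have "\<bar>G m \<xi>\<bar> / fact m * (\<bar>c\<bar> ^ m * \<bar>h\<bar> ^ m) \<le> (\<bar>G m tn\<bar> + 1) / fact m * (\<bar>c\<bar> ^ m * \<bar>h\<bar> ^ m)"
      by (intro mult_right_mono divide_right_mono) auto
    then show ?thesis unfolding \<xi>(2) by (simp add: abs_mult power_abs power_mult_distrib mult_ac)
  qed
  have "\<delta> / (\<bar>c\<bar> + 1) > 0" using \<delta>(1) by simp
  then show ?thesis
    using * by (intro bigoI[of _ ?B]) (auto simp: eventually_at dist_real_def power_abs)
qed

text \<open>The coefficients \<open>l\<close> do not depend on \<open>c\<close>: the matrices \<open>L(t\<^sub>n + h \<gamma>\<^sub>i\<^sub>i)\<close> of all stages share them.\<close>

lemma smooth_matrix_Taylor: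
  assumes "smooth_matrix N L" "\<nu> < N" "\<mu> < N" "m > 0"
  shows "\<exists>l. \<forall>c. (\<lambda>h. L (tn + h * c) \<nu> \<mu> - (\<Sum>q<m. l q * (h * c) ^ q)) \<in> O[at 0](\<lambda>h. h ^ m)"
proof -
  let ?G = "\<lambda>k. (deriv ^^ k) (\<lambda>t. L t \<nu> \<mu>)"
  have "(?G q has_real_derivative ?G (Suc q) t) (at t)" for q t
  proof -
    have "?G q differentiable_on UNIV" using assms unfolding smooth_matrix_def by blast
    then have "?G q differentiable (at t)" by (simp add: differentiable_on_def)
    then show ?thesis by (simp add: DERIV_deriv_iff_real_differentiable)
  qed
  from Taylor_bigo[of ?G, OF this assms(4)] show ?thesis
    by (intro exI[of _ "\<lambda>q. ?G q tn / fact q"]) simp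
qed

lemma smooth_matrix_bounded:
  assumes "smooth_matrix N L" "\<nu> < N" "\<mu> < N"
  shows "(\<lambda>h. L (tn + h * c) \<nu> \<mu>) \<in> O[at 0](\<lambda>h. 1)"
proof -
  obtain l where "(\<lambda>h. L (tn + h * c) \<nu> \<mu> - (\<Sum>q<1. l q * (h * c) ^ q)) \<in> O[at 0](\<lambda>h. h ^ 1)"
    using smooth_matrix_Taylor[OF assms zero_less_one, of tn] by blast
  then have "(\<lambda>h. L (tn + h * c) \<nu> \<mu> - l 0) \<in> O[at 0](\<lambda>h. h ^ 0)"
    using bigo_mono_power[of 0 1] by simp
  then have "(\<lambda>h. (L (tn + h * c) \<nu> \<mu> - l 0) + l 0) \<in> O[at 0](\<lambda>h. 1)"
    by (intro sum_in_bigo(1)) simp_all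
  then show ?thesis by simp
qed

lemma bigo_uniform:
  assumes "\<And>\<nu>. \<nu> < N \<Longrightarrow> (\<lambda>h. f h \<nu>) \<in> O[F](g)"
  obtains K :: real where "K > 0" "\<forall>\<^sub>F h in F. \<forall>\<nu><(N::nat). \<bar>f h \<nu> :: real\<bar> \<le> K * \<bar>g h\<bar>"
proof -
  have "(\<lambda>h. \<Sum>\<nu><N. \<bar>f h \<nu>\<bar>) \<in> O[F](g)"
    using assms by (intro big_sum_in_bigo) simp_all
  then obtain K where K: "K > 0" "\<forall>\<^sub>F h in F. norm (\<Sum>\<nu><N. \<bar>f h \<nu>\<bar>) \<le> K * norm (g h)"
    by (elim landau_o.bigE)
  from K(2) have "\<forall>\<^sub>F h in F. \<forall>\<nu><N. \<bar>f h \<nu>\<bar> \<le> K * \<bar>g h\<bar>"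
  proof eventually_elim
    case (elim h)
    have "\<bar>f h \<nu>\<bar> \<le> (\<Sum>\<nu><N. \<bar>f h \<nu>\<bar>)" if "\<nu> < N" for \<nu>
      using that by (intro member_le_sum) auto
    moreover have "(\<Sum>\<nu><N. \<bar>f h \<nu>\<bar>) \<le> K * \<bar>g h\<bar>" using elim by simp
    ultimately show ?case using order_trans by blast
  qed
  then show ?thesis using that K(1) by blast
qed

lemma eventually_at_0_small:
  "\<epsilon> > 0 \<Longrightarrow> \<forall>\<^sub>F h::real in at 0. K * \<bar>h\<bar> < \<epsilon>"
proof -
  assume "\<epsilon> > 0"
  moreover have "((\<lambda>h::real. K * \<bar>h\<bar>) \<longlongrightarrow> K * \<bar>0\<bar>) (at 0)" by (intro tendsto_intros)
  ultimately show ?thesis by (intro order_tendstoD(2)) simp_all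
qed

lemma smooth_RN_bounded_along:
  assumes "smooth_RN N f" "yn \<in> RN N" "\<forall>\<^sub>F h in at 0. V h \<in> RN N"
    and "\<And>\<nu>. \<nu> < N \<Longrightarrow> (\<lambda>h. V h \<nu> - yn \<nu>) \<in> O[at 0](\<lambda>h. h)"
  shows "(\<lambda>h. f (V h)) \<in> O[at 0](\<lambda>h::real. 1)"
proof -
  obtain B \<delta> where \<delta>: "\<delta> > 0" and B: "\<And>x. x \<in> RN N \<Longrightarrow> (\<forall>i<N. \<bar>x i - yn i\<bar> < \<delta>) \<Longrightarrow> \<bar>f x\<bar> \<le> B"
    using smooth_RN_locally_bounded[OF assms(1,2)] by metis
  obtain K where K: "\<forall>\<^sub>F h in at 0. \<forall>\<nu><N. \<bar>V h \<nu> - yn \<nu>\<bar> \<le> K * \<bar>h\<bar>"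
    using bigo_uniform[of N "\<lambda>h \<nu>. V h \<nu> - yn \<nu>" "at 0" "\<lambda>h. h"] assms(4) by blast
  have "\<forall>\<^sub>F h in at 0. norm (f (V h)) \<le> B * norm (1::real)"
    using assms(3) K eventually_at_0_small[OF \<delta>, of K]
  proof eventually_elim
    case (elim h)
    then have "\<forall>i<N. \<bar>V h i - yn i\<bar> < \<delta>" by (meson le_less_trans)
    then show ?case using B elim(1) by simp
  qed
  then show ?thesis by (rule bigoI)
qed

context lirkw
begin

lemma expands_scale:
  assumes "expands S m f"
  shows "expands S m (\<lambda>i h. c * f i h)"
proof -
  obtain t where t: "combination S t" "\<And>i. i \<le> s \<Longrightarrow> (\<lambda>h. f i h - t i h) \<in> O[at 0](\<lambda>h. h ^ m)"
    using assms unfolding expands_def by blast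
  have "(\<lambda>h. c * (f i h - t i h)) \<in> O[at 0](\<lambda>h. h ^ m)" if "i \<le> s" for i
    using t(2)[OF that] by (cases "c = 0") simp_all
  then show ?thesis
    unfolding expands_def using combination_scale[OF t(1), of c]
    by (intro exI[of _ "\<lambda>i h. c * t i h"]) (simp add: right_diff_distrib)
qed

text \<open>The Taylor remainder is \<open>O(h\<^sup>m)\<close> because the arguments are within \<open>O(h)\<close> of \<open>yn\<close>, and the Taylor
  polynomial preserves expansions.\<close>

lemma expands_smooth_RN:
  assumes f: "smooth_RN N f" and yn: "yn \<in> RN N" and m: "m > 0"
    and V: "\<And>i. i \<le> s \<Longrightarrow> \<forall>\<^sub>F h in at 0. V i h \<in> RN N"
    and V1: "\<And>i \<nu>. i \<le> s \<Longrightarrow> \<nu> < N \<Longrightarrow> (\<lambda>h. V i h \<nu> - yn \<nu>) \<in> O[at 0](\<lambda>h. h)"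
    and E: "\<And>\<nu>. \<nu> < N \<Longrightarrow> expands single_trees m (\<lambda>i h. V i h \<nu> - yn \<nu>)"
  shows "expands forests m (\<lambda>i h. f (V i h))"
proof -
  obtain P C \<delta> where P: "polyfun N P" and \<delta>: "\<delta> > 0" and
    bnd: "\<forall>x\<in>RN N. \<forall>r\<le>\<delta>. (\<forall>i<N. \<bar>x i - yn i\<bar> \<le> r) \<longrightarrow> 0 \<le> r \<longrightarrow>
       \<bar>f x - P (\<lambda>i. x i - yn i)\<bar> \<le> C * r ^ m"
    using smooth_RN_Taylor[OF f yn m] by (elim exE conjE) (rule that)
  have "(\<lambda>h. f (V i h) - P (\<lambda>\<nu>. V i h \<nu> - yn \<nu>)) \<in> O[at 0](\<lambda>h. h ^ m)" if i: "i \<le> s" for i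
  proof -
    obtain K where K: "K > 0" "\<forall>\<^sub>F h in at 0. \<forall>\<nu><N. \<bar>V i h \<nu> - yn \<nu>\<bar> \<le> K * \<bar>h\<bar>"
      using bigo_uniform[of N "\<lambda>h \<nu>. V i h \<nu> - yn \<nu>" "at 0" "\<lambda>h. h"] V1[OF i] by blast
    have "\<forall>\<^sub>F h in at 0. norm (f (V i h) - P (\<lambda>\<nu>. V i h \<nu> - yn \<nu>)) \<le> (C * K ^ m) * norm (h ^ m)"
      using V[OF i] K(2) eventually_at_0_small[OF \<delta>, of K]
    proof eventually_elim
      case (elim h)
      then have "\<bar>f (V i h) - P (\<lambda>\<nu>. V i h \<nu> - yn \<nu>)\<bar> \<le> C * (K * \<bar>h\<bar>) ^ m"
        using K(1) by (intro bnd[rule_format]) auto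
      then show ?case by (simp add: power_mult_distrib power_abs mult.assoc)
    qed
    then show ?thesis by (rule bigoI)
  qed
  then show ?thesis
    by (rule expands_cong[OF _ expands_polyfun[OF P E]])
qed

lemma expands_graft_Meagre:
  assumes "expands forests m f"
    and D: "\<forall>\<^sub>F h in nhds 0. (D has_real_derivative f 0 h) (at h)" "D 0 = 0"
  shows "expands single_trees (Suc m) (\<lambda>i h. if i = 0 then D h else h * (\<Sum>j=1..s. a i j * f j h))"
proof -
  obtain t where t: "combination forests t" "\<And>i. i \<le> s \<Longrightarrow> (\<lambda>h. f i h - t i h) \<in> O[at 0](\<lambda>h. h ^ m)"
    using assms unfolding expands_def by blast
  obtain T where T: "combination single_trees T"
    "\<And>i h. i \<in> {1..s} \<Longrightarrow> T i h = h * (\<Sum>j=1..s. a i j * t j h)"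
    "\<And>h. (T 0 has_real_derivative t 0 h) (at h)" "T 0 0 = 0"
    using combination_graft_Meagre[OF t(1)] by blast
  show ?thesis
    unfolding expands_def
  proof (intro exI[of _ T] conjI allI impI)
    fix i assume i: "i \<le> s"
    show "(\<lambda>h. (if i = 0 then D h else h * (\<Sum>j=1..s. a i j * f j h)) - T i h) \<in> O[at 0](\<lambda>h. h ^ Suc m)"
    proof (cases "i = 0")
      case True
      have "(\<lambda>h. D h - T 0 h) \<in> O[at 0](\<lambda>h. h ^ Suc m)"
      proof (rule bigo_integrate)
        show "\<forall>\<^sub>F h in nhds 0. ((\<lambda>h. D h - T 0 h) has_real_derivative f 0 h - t 0 h) (at h)"
          using D(1) by eventually_elim (rule DERIV_diff[OF _ T(3)])
      qed (use D(2) T(4) t(2) in simp_all)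
      then show ?thesis using True by simp
    next
      case False
      have "(\<lambda>h. a i j * (f j h - t j h)) \<in> O[at 0](\<lambda>h. h ^ m)" if "j \<in> {1..s}" for j
        using t(2)[of j] that by (cases "a i j = 0") simp_all
      then have "(\<lambda>h. h * (\<Sum>j=1..s. a i j * (f j h - t j h))) \<in> O[at 0](\<lambda>h. h ^ Suc m)"
        by (intro bigo_id_mult big_sum_in_bigo)
      then show ?thesis
        using False i T(2)[of i] by (simp add: right_diff_distrib sum_subtractf)
    qed
  qed (rule T(1))
qed

lemma bigo_sum_scaled:
  fixes c :: "nat \<Rightarrow> real"
  assumes "\<And>j. j \<in> J \<Longrightarrow> f j \<in> O[F](g)"
  shows "(\<lambda>h. \<Sum>j\<in>J. c j * f j h) \<in> O[F](g)"
proof (rule big_sum_in_bigo)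
  show "(\<lambda>h. c j * f j h) \<in> O[F](g)" if "j \<in> J" for j
    using assms[OF that] by (cases "c j = 0") simp_all
qed

lemma expands_graft_theta:
  assumes "expands (insert {#} single_trees) m f"
  shows "expands single_trees (Suc m)
    (\<lambda>i h. if i = 0 then 0 else h * (h * gam i i) ^ q * (\<Sum>j=1..s. gam i j * f j h))"
proof -
  obtain t where t: "combination (insert {#} single_trees) t"
    "\<And>i. i \<le> s \<Longrightarrow> (\<lambda>h. f i h - t i h) \<in> O[at 0](\<lambda>h. h ^ m)"
    using assms unfolding expands_def by blast
  obtain T where T: "combination single_trees T"
    "\<And>i h. i \<in> {1..s} \<Longrightarrow> T i h = h * (h * gam i i) ^ q * (\<Sum>j=1..s. gam i j * t j h)"
    "\<And>h. T 0 h = 0"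
    using combination_graft_theta[OF t(1)] by blast
  show ?thesis
    unfolding expands_def
  proof (intro exI[of _ T] conjI allI impI)
    fix i assume i: "i \<le> s"
    show "(\<lambda>h. (if i = 0 then 0 else h * (h * gam i i) ^ q * (\<Sum>j=1..s. gam i j * f j h)) - T i h)
      \<in> O[at 0](\<lambda>h. h ^ Suc m)"
    proof (cases "i = 0")
      case True
      then show ?thesis using T(3) by simp
    next
      case False
      have "(\<lambda>h. \<Sum>j=1..s. gam i j * (f j h - t j h)) \<in> O[at 0](\<lambda>h. h ^ m)"
        using t(2) by (intro bigo_sum_scaled) simp
      moreover have "(\<lambda>h. gam i i ^ q * h ^ q) \<in> O[at 0](\<lambda>h. h ^ 0)"
        using bigo_power_mono[of 0 q] by (cases "gam i i ^ q = 0") simp_all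
      then have "(\<lambda>h. (h * gam i i) ^ q) \<in> O[at 0](\<lambda>h. 1)"
        by (simp add: power_mult_distrib mult.commute)
      ultimately have "(\<lambda>h. (h * gam i i) ^ q * (\<Sum>j=1..s. gam i j * (f j h - t j h))) \<in> O[at 0](\<lambda>h. 1 * h ^ m)"
        by (intro landau_o.big.mult)
      then have "(\<lambda>h. h * ((h * gam i i) ^ q * (\<Sum>j=1..s. gam i j * (f j h - t j h)))) \<in> O[at 0](\<lambda>h. h ^ Suc m)"
        by (intro bigo_id_mult) simp
      then show ?thesis
        using False i T(2)[of i] by (simp add: right_diff_distrib sum_subtractf mult.assoc)
    qed
  qed (rule T(1))
qed

text \<open>The term of degree \<open>q\<close> in the expansion of the matrix entry contributes \<open>(h \<gamma>\<^sub>i\<^sub>i)\<^sup>q\<close>, the factor of a chain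
  of \<open>q\<close> squares.\<close>

lemma expands_graft_matrix_entry:
  assumes f: "expands (insert {#} single_trees) m f"
    and l: "\<And>c. (\<lambda>h. L (tn + h * c) - (\<Sum>q<m. l q * (h * c) ^ q)) \<in> O[at 0](\<lambda>h. h ^ m)"
  shows "expands single_trees (Suc m)
    (\<lambda>i h. if i = 0 then 0 else h * L (tn + h * gam i i) * (\<Sum>j=1..s. gam i j * f j h))"
proof -
  let ?f = "\<lambda>q i h. if i = 0 then 0 else h * (h * gam i i) ^ q * (\<Sum>j=1..s. gam i j * f j h)"
  have "expands single_trees (Suc m) (\<lambda>i h. \<Sum>q<m. l q * ?f q i h)"
    by (intro expands_sum expands_scale expands_graft_theta f)
  then show ?thesis
  proof (rule expands_cong[rotated])
    fix i assume i: "i \<le> s"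
    show "(\<lambda>h. (if i = 0 then 0 else h * L (tn + h * gam i i) * (\<Sum>j=1..s. gam i j * f j h))
      - (\<Sum>q<m. l q * ?f q i h)) \<in> O[at 0](\<lambda>h. h ^ Suc m)"
    proof (cases "i = 0")
      case False
      have "(\<lambda>h. \<Sum>j=1..s. gam i j * f j h) \<in> O[at 0](\<lambda>h. 1)"
        using expands_bounded[OF f] by (intro bigo_sum_scaled) simp
      then have "(\<lambda>h. (L (tn + h * gam i i) - (\<Sum>q<m. l q * (h * gam i i) ^ q)) *
          (\<Sum>j=1..s. gam i j * f j h)) \<in> O[at 0](\<lambda>h. h ^ m * 1)"
        by (intro landau_o.big.mult l)
      then have "(\<lambda>h. h * ((L (tn + h * gam i i) - (\<Sum>q<m. l q * (h * gam i i) ^ q)) *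
          (\<Sum>j=1..s. gam i j * f j h))) \<in> O[at 0](\<lambda>h. h ^ Suc m)"
        by (intro bigo_id_mult) simp
      moreover have "h * L' * S - (\<Sum>q<m. l q * (h * (h * gam i i) ^ q * S))
          = h * ((L' - (\<Sum>q<m. l q * (h * gam i i) ^ q)) * S)" for h L' S
        by (simp add: algebra_simps sum_distrib_left)
      ultimately show ?thesis using False by simp
    qed simp
  qed
qed

end


section \<open>Expansion of the stages and of the exact solution\<close>

locale lirkw_run = lirkw s a gam for s and a gam :: "nat \<Rightarrow> nat \<Rightarrow> real" +
  fixes N :: nat and F :: "(nat \<Rightarrow> real) \<Rightarrow> nat \<Rightarrow> real" and L :: "real \<Rightarrow> nat \<Rightarrow> nat \<Rightarrow> real"
    and tn :: real and yn :: "nat \<Rightarrow> real" and y :: "real \<Rightarrow> nat \<Rightarrow> real"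
    and Y :: "real \<Rightarrow> nat \<Rightarrow> nat \<Rightarrow> real"
  assumes a_lower: "\<And>i j. i \<in> {1..s} \<Longrightarrow> j \<in> {1..s} \<Longrightarrow> j \<ge> i \<Longrightarrow> a i j = 0"
    and gam_lower: "\<And>i j. i \<in> {1..s} \<Longrightarrow> j \<in> {1..s} \<Longrightarrow> j > i \<Longrightarrow> gam i j = 0"
    and F_smooth: "smooth_vector_field N F"
    and L_smooth: "smooth_matrix N L"
    and yn: "yn \<in> RN N"
    and solution: "local_solution N F tn yn y"
    and stages_RN: "\<And>i. i \<in> {1..s} \<Longrightarrow> \<forall>\<^sub>F h in at 0. Y h i \<in> RN N"
    and stages: "\<And>i. i \<in> {1..s} \<Longrightarrow> \<forall>\<^sub>F h in at 0. \<forall>\<nu><N. Y h i \<nu> =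
        yn \<nu> + h * (\<Sum>j\<in>{1..<i}. a i j * F (Y h j) \<nu>)
        + h * mat_vec N (L (tn + h * gam i i)) (\<lambda>\<mu>. \<Sum>j=1..i. gam i j * Y h j \<mu>) \<nu>"
begin

definition V :: "nat \<Rightarrow> real \<Rightarrow> nat \<Rightarrow> real" where
  "V i h = (if i = 0 then y (tn + h) else Y h i)"

lemma F_component: "\<nu> < N \<Longrightarrow> smooth_RN N (\<lambda>x. F x \<nu>)"
  using F_smooth by (simp add: smooth_vector_field_def)

lemma sum_a: "i \<in> {1..s} \<Longrightarrow> (\<Sum>j=1..s. a i j * x j) = (\<Sum>j\<in>{1..<i}. a i j * x j)"
  by (rule sum.mono_neutral_right) (auto intro: a_lower)

lemma sum_gam: "i \<in> {1..s} \<Longrightarrow> (\<Sum>j=1..s. gam i j * x j) = (\<Sum>j=1..i. gam i j * x j)"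
  by (rule sum.mono_neutral_right) (auto intro: gam_lower)

lemma y_RN: "\<forall>\<^sub>F h in nhds 0. y (tn + h) \<in> RN N"
  and y_deriv: "\<nu> < N \<Longrightarrow>
    \<forall>\<^sub>F h in nhds 0. ((\<lambda>h. y (tn + h) \<nu> - yn \<nu>) has_real_derivative F (y (tn + h)) \<nu>) (at h)"
proof -
  obtain \<epsilon> where \<epsilon>: "\<epsilon> > 0" "\<And>t. \<bar>t - tn\<bar> < \<epsilon> \<Longrightarrow> y t \<in> RN N"
    "\<And>t \<nu>. \<bar>t - tn\<bar> < \<epsilon> \<Longrightarrow> \<nu> < N \<Longrightarrow> ((\<lambda>\<tau>. y \<tau> \<nu>) has_real_derivative F (y t) \<nu>) (at t)"
    using solution unfolding local_solution_def by blast
  show "\<forall>\<^sub>F h in nhds 0. y (tn + h) \<in> RN N"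
    using \<epsilon>(1,2) unfolding eventually_nhds_metric by (intro exI[of _ \<epsilon>]) (auto simp: dist_real_def)
  show "\<forall>\<^sub>F h in nhds 0. ((\<lambda>h. y (tn + h) \<nu> - yn \<nu>) has_real_derivative F (y (tn + h)) \<nu>) (at h)"
    if "\<nu> < N"
    unfolding eventually_nhds_metric
  proof (intro exI[of _ \<epsilon>] conjI allI impI)
    fix h :: real assume "dist h 0 < \<epsilon>"
    then have "((\<lambda>\<tau>. y \<tau> \<nu>) has_real_derivative F (y (tn + h)) \<nu>) (at (tn + h))"
      using \<epsilon>(3) that by (simp add: dist_real_def)
    then have "((\<lambda>h. y (tn + h) \<nu>) has_real_derivative F (y (tn + h)) \<nu>) (at h)"
      by (simp add: DERIV_shift add.commute)
    from DERIV_diff[OF this DERIV_const]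
    show "((\<lambda>h. y (tn + h) \<nu> - yn \<nu>) has_real_derivative F (y (tn + h)) \<nu>) (at h)" by simp
  qed (rule \<epsilon>(1))
qed

lemma y_tn: "y tn = yn"
  using solution by (simp add: local_solution_def)

lemma V_RN: "i \<le> s \<Longrightarrow> \<forall>\<^sub>F h in at 0. V i h \<in> RN N"
  using stages_RN[of i] y_RN by (cases "i = 0") (simp_all add: V_def eventually_nhds_conv_at)

text \<open>The stage \<open>i\<close> occurs on both sides of its equation, through \<open>h \<gamma>\<^sub>i\<^sub>i L\<^sub>i Y\<^sub>i\<close>.  With \<open>S\<close> the sum norm of \<open>Y\<^sub>i\<close>
  this gives \<open>S \<le> A + c \<bar>h\<bar> S\<close>, where \<open>A\<close> is bounded by the induction hypothesis on earlier stages; for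
  \<open>c \<bar>h\<bar> \<le> 1/2\<close> it follows that \<open>S \<le> 2 A\<close>.  So every solution of the implicit equations is bounded, without
  solving them, and then the equation shows that it is within \<open>O(h)\<close> of \<open>yn\<close>.\<close>

lemma stage_diff_bigo:
  assumes "i \<in> {1..s}" "\<nu> < N"
  shows "(\<lambda>h. Y h i \<nu> - yn \<nu>) \<in> O[at 0](\<lambda>h. h)"
  using assms
proof (induction i arbitrary: \<nu> rule: less_induct)
  case (less i)
  have Y_bdd: "(\<lambda>h. Y h j \<mu>) \<in> O[at 0](\<lambda>h. 1)" if "j \<in> {1..<i}" "\<mu> < N" for j \<mu>
  proof -
    have "(\<lambda>h::real. h) \<in> O[at 0](\<lambda>h. 1)" using bigo_power_mono[of 0 1] by simp
    then have "(\<lambda>h. Y h j \<mu> - yn \<mu>) \<in> O[at 0](\<lambda>h. 1)"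
      using less.IH[of j \<mu>] that less.prems landau_o.big_trans by fastforce
    then have "(\<lambda>h. Y h j \<mu> - yn \<mu> + yn \<mu>) \<in> O[at 0](\<lambda>h. 1)"
      by (intro sum_in_bigo(1)) simp_all
    then show ?thesis by simp
  qed
  have F_bdd: "(\<lambda>h. F (Y h j) \<mu>) \<in> O[at 0](\<lambda>h. 1)" if "j \<in> {1..<i}" "\<mu> < N" for j \<mu>
    by (rule smooth_RN_bounded_along[OF F_component yn stages_RN less.IH])
       (use that less.prems in auto)
  have L_bdd: "(\<lambda>h. L (tn + h * gam i i) \<nu> \<mu>) \<in> O[at 0](\<lambda>h. 1)" if "\<nu> < N" "\<mu> < N" for \<nu> \<mu>
    by (rule smooth_matrix_bounded[OF L_smooth that])
  \<comment> \<open>\<open>E\<close> collects the contributions of earlier stages, \<open>M\<close> that of the stage itself.\<close>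
  define E where "E = (\<lambda>h \<nu>. (\<Sum>j\<in>{1..<i}. a i j * F (Y h j) \<nu>)
      + (\<Sum>\<mu><N. L (tn + h * gam i i) \<nu> \<mu> * (\<Sum>j\<in>{1..<i}. gam i j * Y h j \<mu>)))"
  have E: "(\<lambda>h. E h \<nu>) \<in> O[at 0](\<lambda>h. 1)" if \<nu>: "\<nu> < N" for \<nu>
  proof -
    have "(\<lambda>h. L (tn + h * gam i i) \<nu> \<mu> * (\<Sum>j\<in>{1..<i}. gam i j * Y h j \<mu>)) \<in> O[at 0](\<lambda>h. 1 * 1)"
      if "\<mu> < N" for \<mu>
      by (rule landau_o.big.mult[OF L_bdd[OF \<nu> that] bigo_sum_scaled[OF Y_bdd[OF _ that]]])
    then show ?thesis
      unfolding E_def using F_bdd[OF _ \<nu>]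
      by (intro sum_in_bigo(1) bigo_sum_scaled big_sum_in_bigo) simp_all
  qed
  define S where "S = (\<lambda>h. \<Sum>\<nu><N. \<bar>Y h i \<nu>\<bar>)"
  define M where "M = (\<lambda>h \<nu>. \<Sum>\<mu><N. L (tn + h * gam i i) \<nu> \<mu> * (gam i i * Y h i \<mu>))"
  have eq: "\<forall>\<^sub>F h in at 0. \<forall>\<nu><N. Y h i \<nu> = yn \<nu> + h * E h \<nu> + h * M h \<nu>"
    using stages[OF less.prems(1)]
  proof eventually_elim
    case (elim h)
    have split: "(\<Sum>j=1..i. gam i j * Y h j \<mu>) = (\<Sum>j\<in>{1..<i}. gam i j * Y h j \<mu>) + gam i i * Y h i \<mu>" for \<mu>
    proof -
      have "{1..i} = insert i {1..<i}" using less.prems(1) by auto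
      then show ?thesis by simp
    qed
    have "mat_vec N (L (tn + h * gam i i)) (\<lambda>\<mu>. \<Sum>j=1..i. gam i j * Y h j \<mu>) \<nu>
        = (\<Sum>\<mu><N. L (tn + h * gam i i) \<nu> \<mu> * (\<Sum>j\<in>{1..<i}. gam i j * Y h j \<mu>)) + M h \<nu>" for \<nu>
      unfolding mat_vec_def M_def split by (simp only: distrib_left sum.distrib)
    then show ?case using elim by (simp add: E_def distrib_left)
  qed
  have "(\<lambda>h. \<Sum>\<nu><N. \<Sum>\<mu><N. \<bar>L (tn + h * gam i i) \<nu> \<mu>\<bar>) \<in> O[at 0](\<lambda>h. 1)"
    using L_bdd by (intro big_sum_in_bigo) simp_all
  then obtain B where B: "B > 0"
    "\<forall>\<^sub>F h in at 0. norm (\<Sum>\<nu><N. \<Sum>\<mu><N. \<bar>L (tn + h * gam i i) \<nu> \<mu>\<bar>) \<le> B * norm (1::real)"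
    by (elim landau_o.bigE)
  let ?G = "\<bar>gam i i\<bar>"
  have M_le: "\<forall>\<^sub>F h in at 0. (\<Sum>\<nu><N. \<bar>M h \<nu>\<bar>) \<le> B * ?G * S h"
    using B(2)
  proof eventually_elim
    case (elim h)
    have "\<bar>M h \<nu>\<bar> \<le> (\<Sum>\<mu><N. \<bar>L (tn + h * gam i i) \<nu> \<mu>\<bar>) * (?G * S h)" for \<nu>
    proof -
      have "\<bar>Y h i \<mu>\<bar> \<le> S h" if "\<mu> < N" for \<mu>
        unfolding S_def using that by (intro member_le_sum) auto
      then have "\<bar>L (tn + h * gam i i) \<nu> \<mu> * (gam i i * Y h i \<mu>)\<bar>
          \<le> \<bar>L (tn + h * gam i i) \<nu> \<mu>\<bar> * (?G * S h)" if "\<mu> < N" for \<mu>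
        using that by (simp only: abs_mult) (intro mult_left_mono, auto)
      then show ?thesis
        unfolding M_def sum_distrib_right by (intro order_trans[OF sum_abs] sum_mono) simp
    qed
    then have "(\<Sum>\<nu><N. \<bar>M h \<nu>\<bar>) \<le> (\<Sum>\<nu><N. (\<Sum>\<mu><N. \<bar>L (tn + h * gam i i) \<nu> \<mu>\<bar>) * (?G * S h))"
      by (intro sum_mono)
    also have "\<dots> = (\<Sum>\<nu><N. \<Sum>\<mu><N. \<bar>L (tn + h * gam i i) \<nu> \<mu>\<bar>) * (?G * S h)"
      by (simp add: sum_distrib_right)
    also have "\<dots> \<le> B * (?G * S h)"
      using elim by (intro mult_right_mono) (auto simp: S_def intro!: mult_nonneg_nonneg sum_nonneg)
    finally show ?case by (simp add: mult.assoc)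
  qed
  define A where "A = (\<lambda>h. \<Sum>\<nu><N. \<bar>yn \<nu> + h * E h \<nu>\<bar>)"
  have hE: "(\<lambda>h. h * E h \<nu>) \<in> O[at 0](\<lambda>h. h)" if "\<nu> < N" for \<nu>
    using landau_o.big.mult[OF landau_o.big_refl E[OF that], of "\<lambda>h. h"] by simp
  have id1: "(\<lambda>h::real. h) \<in> O[at 0](\<lambda>h. 1)" using bigo_power_mono[of 0 1] by simp
  have "A \<in> O[at 0](\<lambda>h. 1)"
    unfolding A_def using landau_o.big_trans[OF hE id1]
    by (intro big_sum_in_bigo) (simp add: sum_in_bigo(1))
  have small: "\<forall>\<^sub>F h in at 0. B * ?G * \<bar>h\<bar> < 1/2"
    by (rule eventually_at_0_small) simp
  have "\<forall>\<^sub>F h in at 0. norm (S h) \<le> 2 * norm (A h)"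
    using eq M_le small
  proof eventually_elim
    case (elim h)
    have "S h \<le> A h + \<bar>h\<bar> * (\<Sum>\<nu><N. \<bar>M h \<nu>\<bar>)"
    proof -
      have "\<bar>Y h i \<nu>\<bar> \<le> \<bar>yn \<nu> + h * E h \<nu>\<bar> + \<bar>h\<bar> * \<bar>M h \<nu>\<bar>" if "\<nu> < N" for \<nu>
        using elim(1) that abs_triangle_ineq[of "yn \<nu> + h * E h \<nu>" "h * M h \<nu>"] by (simp add: abs_mult)
      then show ?thesis
        unfolding S_def A_def sum_distrib_left sum.distrib[symmetric] by (intro sum_mono) simp
    qed
    also have "\<bar>h\<bar> * (\<Sum>\<nu><N. \<bar>M h \<nu>\<bar>) \<le> \<bar>h\<bar> * (B * ?G * S h)"
      using elim(2) by (intro mult_left_mono) auto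
    also have "\<bar>h\<bar> * (B * ?G * S h) = (B * ?G * \<bar>h\<bar>) * S h" by simp
    also have "\<dots> \<le> 1/2 * S h"
      using elim(3) by (intro mult_right_mono) (auto simp: S_def sum_nonneg)
    finally have "S h \<le> 2 * A h" by simp
    then show ?case by (simp add: S_def A_def sum_nonneg)
  qed
  then have "S \<in> O[at 0](A)" by (rule bigoI)
  then have S: "S \<in> O[at 0](\<lambda>h. 1)" using \<open>A \<in> O[at 0](\<lambda>h. 1)\<close> by (rule landau_o.big_trans)
  have "(\<lambda>h. M h \<nu>) \<in> O[at 0](S)"
  proof (rule bigoI[of _ "B * ?G"])
    show "\<forall>\<^sub>F h in at 0. norm (M h \<nu>) \<le> B * ?G * norm (S h)"
      using M_le
    proof eventually_elim
      case (elim h)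
      have "\<bar>M h \<nu>\<bar> \<le> (\<Sum>\<nu><N. \<bar>M h \<nu>\<bar>)"
        using less.prems(2) by (intro member_le_sum) auto
      then show ?case using elim by (simp add: S_def sum_nonneg)
    qed
  qed
  then have "(\<lambda>h. M h \<nu>) \<in> O[at 0](\<lambda>h. 1)" using S by (rule landau_o.big_trans)
  then have "(\<lambda>h. h * M h \<nu>) \<in> O[at 0](\<lambda>h. h)"
    using landau_o.big.mult[OF landau_o.big_refl, of _ _ _ "\<lambda>h. h"] by fastforce
  then have "(\<lambda>h. h * E h \<nu> + h * M h \<nu>) \<in> O[at 0](\<lambda>h. h)"
    using hE[OF less.prems(2)] by (rule sum_in_bigo(1)[rotated])
  moreover have "\<forall>\<^sub>F h in at 0. h * E h \<nu> + h * M h \<nu> = Y h i \<nu> - yn \<nu>"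
    using eq by eventually_elim (use less.prems(2) in simp)
  ultimately show ?case by (simp cong: landau_o.big.in_cong)
qed

lemma V_diff_bigo:
  assumes "i \<le> s" "\<nu> < N"
  shows "(\<lambda>h. V i h \<nu> - yn \<nu>) \<in> O[at 0](\<lambda>h. h)"
proof (cases "i = 0")
  case True
  let ?D = "\<lambda>h. y (tn + h) \<nu> - yn \<nu>"
  have "(?D has_real_derivative F (y (tn + 0)) \<nu>) (at 0)"
    using eventually_nhds_x_imp_x[OF y_deriv[OF assms(2)]] .
  then have "((\<lambda>h. ?D h / h) \<longlongrightarrow> F yn \<nu>) (at 0)"
    by (simp add: DERIV_def y_tn)
  then have "?D \<in> O[at 0](\<lambda>h. h)"
    by (rule bigoI_tendsto) (auto simp: eventually_at intro: exI[of _ 1])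
  then show ?thesis using True by (simp add: V_def)
next
  case False
  then show ?thesis using stage_diff_bigo[of i \<nu>] assms by (simp add: V_def)
qed

lemma V_eq:
  assumes "i \<le> s" "\<nu> < N"
  shows "\<forall>\<^sub>F h in at 0. V i h \<nu> - yn \<nu> =
    (if i = 0 then y (tn + h) \<nu> - yn \<nu> else h * (\<Sum>j=1..s. a i j * F (V j h) \<nu>))
    + (\<Sum>\<mu><N. if i = 0 then 0 else h * L (tn + h * gam i i) \<nu> \<mu> * (\<Sum>j=1..s. gam i j * V j h \<mu>))"
proof (cases "i = 0")
  case False
  then have i: "i \<in> {1..s}" using assms by simp
  have FV: "(\<Sum>j=1..s. a i j * F (V j h) \<nu>) = (\<Sum>j\<in>{1..<i}. a i j * F (Y h j) \<nu>)" for h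
    unfolding sum_a[OF i] by (intro sum.cong) (auto simp: V_def)
  have VY: "(\<Sum>j=1..s. gam i j * V j h \<mu>) = (\<Sum>j=1..i. gam i j * Y h j \<mu>)" for h \<mu>
    unfolding sum_gam[OF i] by (intro sum.cong) (auto simp: V_def)
  show ?thesis
    using stages[OF i]
  proof eventually_elim
    case (elim h)
    show ?case
      unfolding FV VY using elim assms(2) False
      by (simp add: V_def mat_vec_def sum_distrib_left mult.assoc)
  qed
qed (simp add: V_def)

text \<open>Every right-hand side carries a factor \<open>h\<close> or is integrated, so an expansion up to \<open>O(h\<^sup>m)\<close> on the right
  yields one up to \<open>O(h\<^bsup>m+1\<^esup>)\<close> on the left.  This holds for the stage \<open>i\<close> on its own right-hand side too, so the
  induction is on \<open>m\<close> for all stages simultaneously.  It starts with the zero combination.\<close>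

lemma expands_V:
  assumes "m > 0" "\<nu> < N"
  shows "expands single_trees m (\<lambda>i h. V i h \<nu> - yn \<nu>)"
  using assms
proof (induction m arbitrary: \<nu> rule: nat_induct_non_zero)
  case 1
  show ?case
    unfolding expands_def
    by (intro exI[of _ "\<lambda>i h. 0"]) (use V_diff_bigo 1 in \<open>auto intro: combination.zero\<close>)
next
  case (Suc m)
  have FE: "expands forests m (\<lambda>i h. F (V i h) \<nu>)"
    by (rule expands_smooth_RN[OF F_component yn \<open>m > 0\<close> V_RN V_diff_bigo Suc.IH])
       (use Suc.prems in auto)
  have VE: "expands (insert {#} single_trees) m (\<lambda>i h. V i h \<mu>)" if "\<mu> < N" for \<mu>
    by (rule expands_shift[OF Suc.IH[OF that]])
  let ?M = "\<lambda>i h. if i = 0 then y (tn + h) \<nu> - yn \<nu> else h * (\<Sum>j=1..s. a i j * F (V j h) \<nu>)"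
  let ?T = "\<lambda>\<mu> i h. if i = 0 then 0 else h * L (tn + h * gam i i) \<nu> \<mu> * (\<Sum>j=1..s. gam i j * V j h \<mu>)"
  have "expands single_trees (Suc m) ?M"
    using y_deriv[OF Suc.prems] y_tn
    by (intro expands_graft_Meagre[OF FE, of "\<lambda>h. y (tn + h) \<nu> - yn \<nu>"]) (simp_all add: V_def)
  moreover have "expands single_trees (Suc m) (?T \<mu>)" if \<mu>: "\<mu> < N" for \<mu>
  proof -
    obtain l where "\<And>c. (\<lambda>h. L (tn + h * c) \<nu> \<mu> - (\<Sum>q<m. l q * (h * c) ^ q)) \<in> O[at 0](\<lambda>h. h ^ m)"
      using smooth_matrix_Taylor[OF L_smooth Suc.prems \<mu> \<open>m > 0\<close>, of tn] by blast
    then show ?thesis by (rule expands_graft_matrix_entry[OF VE[OF \<mu>], of "\<lambda>t. L t \<nu> \<mu>"])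
  qed
  ultimately have "expands single_trees (Suc m) (\<lambda>i h. ?M i h + (\<Sum>\<mu><N. ?T \<mu> i h))"
    by (intro expands_add expands_sum) (simp_all only: lessThan_iff)
  then show ?case
  proof (rule expands_cong[rotated])
    fix i assume "i \<le> s"
    from V_eq[OF this Suc.prems]
    show "(\<lambda>h. V i h \<nu> - yn \<nu> - (?M i h + (\<Sum>\<mu><N. ?T \<mu> i h))) \<in> O[at 0](\<lambda>h. h ^ Suc m)"
      by (intro bigo_eventually_zero) (auto elim: eventually_mono)
  qed
qed

end

section \<open>Sufficiency of the order conditions\<close>

context lirkw
begin

definition conditions :: "(nat \<Rightarrow> real) \<Rightarrow> (nat \<Rightarrow> real) \<Rightarrow> nat \<Rightarrow> bool" where
  "conditions b g p \<longleftrightarrow>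
    (\<forall>\<tau>\<in>LW3. tree_order \<tau> \<le> p \<longrightarrow> (\<Sum>j=1..s. Phi s a gam b g \<tau> j) = exact_weight \<tau>)"

lemma conditions_bigo:
  assumes "conditions b g p" "\<tau> \<in> LW3"
  shows "(\<lambda>h. h ^ tree_order \<tau> * (\<Sum>j=1..s. Phi s a gam b g \<tau> j) - h ^ tree_order \<tau> * exact_weight \<tau>)
    \<in> O[at 0](\<lambda>h. h ^ Suc p)"
proof (cases "tree_order \<tau> \<le> p")
  case True
  then show ?thesis using assms by (simp add: conditions_def)
next
  case False
  then have "(\<lambda>h::real. h ^ tree_order \<tau>) \<in> O[at 0](\<lambda>h. h ^ Suc p)"
    by (intro bigo_power_mono) simp
  from landau_o.big.mult[OF this bigo_const, of "(\<Sum>j=1..s. Phi s a gam b g \<tau> j) - exact_weight \<tau>"]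
  show ?thesis by (simp add: right_diff_distrib)
qed

text \<open>The meagre contribution to \<open>y\<^bsub>n+1\<^esub>\<close> minus the exact increment.  On a forest term this difference is
  \<open>h\<^bsup>\<rho>(\<tau>)\<^esup> (\<Sum>\<^sub>j \<Phi>\<^sub>j(\<tau>) - exact_weight \<tau>)\<close> for the tree \<open>\<tau>\<close> with a meagre root above the forest.\<close>

lemma combination_result_Meagre:
  assumes "combination forests t" and cond: "conditions b g p"
  shows "\<exists>T. (\<forall>h. (T has_real_derivative t 0 h) (at h)) \<and> T 0 = 0 \<and>
    (\<lambda>h. h * (\<Sum>j=1..s. b j * t j h) - T h) \<in> O[at 0](\<lambda>h. h ^ Suc p)"
  using assms(1)
proof induction
  case zero
  show ?case by (intro exI[of _ "\<lambda>h. 0"]) simp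
next
  case (add ts f c)
  then obtain T where T: "\<And>h. (T has_real_derivative f 0 h) (at h)" "T 0 = 0"
    "(\<lambda>h. h * (\<Sum>j=1..s. b j * f j h) - T h) \<in> O[at 0](\<lambda>h. h ^ Suc p)"
    by blast
  let ?\<tau> = "Node Meagre ts"
  let ?G = "\<lambda>h. c * forest_term {#?\<tau>#} 0 h + T h"
  from DERIV_add[OF DERIV_cmult[OF forest_term_Meagre_exact] T(1)]
  have 1: "(?G has_real_derivative c * forest_term ts 0 h + f 0 h) (at h)" for h .
  have 2: "?G 0 = 0" using T(2) by (simp add: forest_term_Meagre_exact_0)
  have "?\<tau> \<in> LW3" using add(1) by (simp add: LW3_iff LW3_sub_Meagre forests_def)
  from conditions_bigo[OF cond this]
  have "(\<lambda>h. h * (\<Sum>j=1..s. b j * forest_term ts j h) - forest_term {#?\<tau>#} 0 h) \<in> O[at 0](\<lambda>h. h ^ Suc p)"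
    unfolding forest_term_result_Meagre[where g = g] by (simp add: forest_term_def weight_def)
  from landau_o.big.mult[OF bigo_const this, of c]
  have "(\<lambda>h. c * (h * (\<Sum>j=1..s. b j * forest_term ts j h) - forest_term {#?\<tau>#} 0 h)) \<in> O[at 0](\<lambda>h. h ^ Suc p)"
    by simp
  from sum_in_bigo(1)[OF this T(3)]
  have 3: "(\<lambda>h. h * (\<Sum>j=1..s. b j * (c * forest_term ts j h + f j h)) - ?G h) \<in> O[at 0](\<lambda>h. h ^ Suc p)"
    by (simp add: algebra_simps sum.distrib sum_distrib_left)
  show ?case by (intro exI[of _ ?G]) (use 1 2 3 in blast)
qed

text \<open>Trees with a fat root have exact weight \<open>0\<close>, so the contribution of \<open>L\<close> to \<open>y\<^bsub>n+1\<^esub>\<close> is small by itself.  No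
  chains of squares arise here, because the last formula of the method uses \<open>L(t\<^sub>n)\<close>.\<close>

lemma combination_result_Fat:
  assumes "combination (insert {#} single_trees) t" and cond: "conditions b g p"
  shows "(\<lambda>h. h * (\<Sum>j=1..s. g j * t j h)) \<in> O[at 0](\<lambda>h. h ^ Suc p)"
  using assms(1)
proof induction
  case (add ts f c)
  let ?\<tau> = "Node Fat ts"
  have "?\<tau> \<in> LW3" using add(1) by (auto simp: LW3_iff LW3_sub_Fat single_trees_def)
  from conditions_bigo[OF cond this]
  have "(\<lambda>h. h * (\<Sum>j=1..s. g j * forest_term ts j h)) \<in> O[at 0](\<lambda>h. h ^ Suc p)"
    unfolding forest_term_result_Fat[where b = b] by simp
  from landau_o.big.mult[OF bigo_const this, of c]
  have "(\<lambda>h. c * (h * (\<Sum>j=1..s. g j * forest_term ts j h))) \<in> O[at 0](\<lambda>h. h ^ Suc p)"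
    by simp
  from sum_in_bigo(1)[OF this add(3)]
  show ?case by (simp add: algebra_simps sum.distrib sum_distrib_left)
qed simp

lemma expands_result_Meagre:
  assumes "expands forests p f" and cond: "conditions b g p"
    and D: "\<forall>\<^sub>F h in nhds 0. (D has_real_derivative f 0 h) (at h)" "D 0 = 0"
  shows "(\<lambda>h. h * (\<Sum>j=1..s. b j * f j h) - D h) \<in> O[at 0](\<lambda>h. h ^ Suc p)"
proof -
  obtain t where t: "combination forests t" "\<And>i. i \<le> s \<Longrightarrow> (\<lambda>h. f i h - t i h) \<in> O[at 0](\<lambda>h. h ^ p)"
    using assms unfolding expands_def by blast
  obtain T where T: "\<And>h. (T has_real_derivative t 0 h) (at h)" "T 0 = 0"
    "(\<lambda>h. h * (\<Sum>j=1..s. b j * t j h) - T h) \<in> O[at 0](\<lambda>h. h ^ Suc p)"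
    using combination_result_Meagre[OF t(1) cond] by blast
  have "(\<lambda>h. D h - T h) \<in> O[at 0](\<lambda>h. h ^ Suc p)"
  proof (rule bigo_integrate)
    show "\<forall>\<^sub>F h in nhds 0. ((\<lambda>h. D h - T h) has_real_derivative f 0 h - t 0 h) (at h)"
      using D(1) by eventually_elim (rule DERIV_diff[OF _ T(1)])
  qed (use D(2) T(2) t(2) in simp_all)
  moreover have "(\<lambda>h. h * (\<Sum>j=1..s. b j * (f j h - t j h))) \<in> O[at 0](\<lambda>h. h ^ Suc p)"
    using t(2) by (intro bigo_id_mult bigo_sum_scaled) simp
  ultimately have "(\<lambda>h. h * (\<Sum>j=1..s. b j * (f j h - t j h)) - (D h - T h)
      + (h * (\<Sum>j=1..s. b j * t j h) - T h)) \<in> O[at 0](\<lambda>h. h ^ Suc p)"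
    using T(3) sum_in_bigo by blast
  then show ?thesis by (simp add: right_diff_distrib sum_subtractf)
qed

lemma expands_result_Fat:
  assumes "expands (insert {#} single_trees) p f" and cond: "conditions b g p"
  shows "(\<lambda>h. h * (\<Sum>j=1..s. g j * f j h)) \<in> O[at 0](\<lambda>h. h ^ Suc p)"
proof -
  obtain t where t: "combination (insert {#} single_trees) t"
    "\<And>i. i \<le> s \<Longrightarrow> (\<lambda>h. f i h - t i h) \<in> O[at 0](\<lambda>h. h ^ p)"
    using assms unfolding expands_def by blast
  have "(\<lambda>h. h * (\<Sum>j=1..s. g j * (f j h - t j h))) \<in> O[at 0](\<lambda>h. h ^ Suc p)"
    using t(2) by (intro bigo_id_mult bigo_sum_scaled) simp
  from sum_in_bigo(1)[OF this combination_result_Fat[OF t(1) cond]]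
  show ?thesis by (simp add: right_diff_distrib sum_subtractf)
qed

end

context lirkw_run
begin

lemma expands_F:
  assumes "m > 0" "\<nu> < N"
  shows "expands forests m (\<lambda>i h. F (V i h) \<nu>)"
  by (rule expands_smooth_RN[OF F_component yn \<open>m > 0\<close> V_RN V_diff_bigo expands_V])
     (use assms in auto)

lemma result_bigo:
  assumes "p > 0" "conditions b g p" "\<nu> < N"
    and z: "\<forall>\<^sub>F h in at 0. z h \<nu> = yn \<nu> + h * (\<Sum>j=1..s. b j * F (Y h j) \<nu>)
      + h * mat_vec N (L tn) (\<lambda>\<mu>. \<Sum>j=1..s. g j * Y h j \<mu>) \<nu>"
  shows "(\<lambda>h. z h \<nu> - y (tn + h) \<nu>) \<in> O[at 0](\<lambda>h. h ^ Suc p)"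
proof -
  have F: "(\<lambda>h. h * (\<Sum>j=1..s. b j * F (V j h) \<nu>) - (y (tn + h) \<nu> - yn \<nu>)) \<in> O[at 0](\<lambda>h. h ^ Suc p)"
    using y_deriv[OF assms(3)] y_tn
    by (intro expands_result_Meagre[OF expands_F[OF assms(1,3)] assms(2)]) (simp_all add: V_def)
  have "(\<lambda>h. L tn \<nu> \<mu> * (h * (\<Sum>j=1..s. g j * V j h \<mu>))) \<in> O[at 0](\<lambda>h. 1 * h ^ Suc p)" if "\<mu> < N" for \<mu>
    by (intro landau_o.big.mult bigo_const expands_result_Fat[OF expands_shift[OF expands_V[OF assms(1) that]] assms(2)])
  then have "(\<lambda>h. \<Sum>\<mu><N. L tn \<nu> \<mu> * (h * (\<Sum>j=1..s. g j * V j h \<mu>))) \<in> O[at 0](\<lambda>h. h ^ Suc p)"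
    by (intro big_sum_in_bigo) simp
  from sum_in_bigo(1)[OF F this]
  have "(\<lambda>h. h * (\<Sum>j=1..s. b j * F (V j h) \<nu>) - (y (tn + h) \<nu> - yn \<nu>)
    + (\<Sum>\<mu><N. L tn \<nu> \<mu> * (h * (\<Sum>j=1..s. g j * V j h \<mu>)))) \<in> O[at 0](\<lambda>h. h ^ Suc p)" .
  moreover have "\<forall>\<^sub>F h in at 0. h * (\<Sum>j=1..s. b j * F (V j h) \<nu>) - (y (tn + h) \<nu> - yn \<nu>)
    + (\<Sum>\<mu><N. L tn \<nu> \<mu> * (h * (\<Sum>j=1..s. g j * V j h \<mu>))) = z h \<nu> - y (tn + h) \<nu>"
    using z
  proof eventually_elim
    case (elim h)
    have FV: "(\<Sum>j=1..s. b j * F (V j h) \<nu>) = (\<Sum>j=1..s. b j * F (Y h j) \<nu>)"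
      by (intro sum.cong) (auto simp: V_def)
    have VY: "(\<Sum>j=1..s. g j * V j h \<mu>) = (\<Sum>j=1..s. g j * Y h j \<mu>)" for \<mu>
      by (intro sum.cong) (auto simp: V_def)
    have "h * mat_vec N (L tn) (\<lambda>\<mu>. \<Sum>j=1..s. g j * Y h j \<mu>) \<nu>
        = (\<Sum>\<mu><N. L tn \<nu> \<mu> * (h * (\<Sum>j=1..s. g j * Y h j \<mu>)))"
      by (simp add: mat_vec_def sum_distrib_left mult_ac)
    then show ?case unfolding FV VY elim by simp
  qed
  ultimately show ?thesis by (rule landau_o.big.in_cong[THEN iffD1, rotated])
qed

end

theorem (in lirkw) order_if_conditions:
  assumes "p > 0" "conditions b g p"
    and a_lower: "\<And>i j. i \<in> {1..s} \<Longrightarrow> j \<in> {1..s} \<Longrightarrow> j \<ge> i \<Longrightarrow> a i j = 0"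
    and gam_lower: "\<And>i j. i \<in> {1..s} \<Longrightarrow> j \<in> {1..s} \<Longrightarrow> j > i \<Longrightarrow> gam i j = 0"
  shows "lirkw_has_order s a gam b g p"
  unfolding lirkw_has_order_def
proof (intro allI impI)
  fix N F L tn yn y z \<nu>
  assume F: "smooth_vector_field N F" and L: "smooth_matrix N L" and yn: "yn \<in> RN N"
    and y: "local_solution N F tn yn y" and \<nu>: "\<nu> < N"
    and step: "\<forall>\<^sub>F h in nhds 0. lirkw_step s a gam b g N F L tn yn h (z h)"
  define Q where "Q = (\<lambda>h Y. (\<forall>i\<in>{1..s}. Y i \<in> RN N \<and>
            (\<forall>\<nu><N. Y i \<nu> = yn \<nu> + h * (\<Sum>j\<in>{1..<i}. a i j * F (Y j) \<nu>)
               + h * mat_vec N (L (tn + h * gam i i)) (\<lambda>\<mu>. \<Sum>j=1..i. gam i j * Y j \<mu>) \<nu>)) \<and>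
          (\<forall>\<nu><N. z h \<nu> = yn \<nu> + h * (\<Sum>j=1..s. b j * F (Y j) \<nu>)
               + h * mat_vec N (L tn) (\<lambda>\<mu>. \<Sum>j=1..s. g j * Y j \<mu>) \<nu>))"
  \<comment> \<open>The stages are hidden in the step relation; choose them as functions of \<open>h\<close>.\<close>
  define Y where "Y = (\<lambda>h. SOME Y. Q h Y)"
  have Y: "Q h (Y h)" if "lirkw_step s a gam b g N F L tn yn h (z h)" for h
  proof -
    have "\<exists>Y. Q h Y"
      using that unfolding lirkw_step_def Q_def by (rule conjunct2)
    then show ?thesis unfolding Y_def by (rule someI_ex)
  qed
  have "\<forall>\<^sub>F h in at 0. lirkw_step s a gam b g N F L tn yn h (z h)"
    using step by (simp add: eventually_nhds_conv_at)
  then have "\<forall>\<^sub>F h in at 0. Q h (Y h)"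
    by eventually_elim (rule Y)
  note ev = this[unfolded Q_def]
  interpret lirkw_run s a gam N F L tn yn y Y
  proof
    show "\<forall>\<^sub>F h in at 0. Y h i \<in> RN N" if "i \<in> {1..s}" for i
      using ev by eventually_elim (use that in blast)
    show "\<forall>\<^sub>F h in at 0. \<forall>\<nu><N. Y h i \<nu> =
        yn \<nu> + h * (\<Sum>j\<in>{1..<i}. a i j * F (Y h j) \<nu>)
        + h * mat_vec N (L (tn + h * gam i i)) (\<lambda>\<mu>. \<Sum>j=1..i. gam i j * Y h j \<mu>) \<nu>"
      if "i \<in> {1..s}" for i
      using ev by eventually_elim (use that in blast)
  qed (fact a_lower gam_lower F L yn y)+
  have "\<forall>\<^sub>F h in at 0. z h \<nu> = yn \<nu> + h * (\<Sum>j=1..s. b j * F (Y h j) \<nu>)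
      + h * mat_vec N (L tn) (\<lambda>\<mu>. \<Sum>j=1..s. g j * Y h j \<mu>) \<nu>"
    using ev by eventually_elim (use \<nu> in blast)
  from result_bigo[where z = z, OF assms(1,2) \<nu> this]
  show "(\<lambda>h. z h \<nu> - y (tn + h) \<nu>) \<in> O[at 0](\<lambda>h. h ^ (p + 1))" by simp
qed

section \<open>Necessity of the order conditions\<close>

lemma iterated_deriv_monomial:
  "\<exists>c r. (deriv ^^ k) (\<lambda>t::real. c0 * t ^ q) = (\<lambda>t. c * t ^ r)"
proof (induction k)
  case 0
  show ?case by auto
next
  case (Suc k)
  then obtain c r where eq: "(deriv ^^ k) (\<lambda>t::real. c0 * t ^ q) = (\<lambda>t. c * t ^ r)" by blast
  have "((\<lambda>t. c * t ^ r) has_real_derivative c * real r * t ^ (r - 1)) (at t)" for t :: real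
    by (auto intro!: derivative_eq_intros)
  then have "deriv (\<lambda>t. c * t ^ r) = (\<lambda>t. (c * real r) * t ^ (r - 1))"
    by (auto intro!: DERIV_imp_deriv)
  then have "(deriv ^^ Suc k) (\<lambda>t::real. c0 * t ^ q) = (\<lambda>t. (c * real r) * t ^ (r - 1))"
    by (simp add: eq)
  then show ?case by blast
qed

lemma monomial_iterated_deriv_differentiable:
  "(deriv ^^ k) (\<lambda>t::real. c0 * t ^ q) differentiable_on UNIV"
proof -
  obtain c r where "(deriv ^^ k) (\<lambda>t::real. c0 * t ^ q) = (\<lambda>t. c * t ^ r)"
    using iterated_deriv_monomial by blast
  then show ?thesis by (simp add: differentiable_on_def)
qed

lemma power_coefficient_zero:
  assumes "(\<lambda>h::real. c * h ^ r) \<in> O[at 0](\<lambda>h. h ^ Suc p)" "r \<le> p"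
  shows "c = 0"
proof (rule ccontr)
  assume c: "c \<noteq> 0"
  have "(\<lambda>h::real. c * h ^ r) \<in> O[at 0](\<lambda>h. h ^ Suc r)"
    using bigo_mono_power[OF _ assms(1), of "Suc r"] assms(2) by simp
  then obtain C where C: "C > 0" "\<forall>\<^sub>F h::real in at 0. norm (c * h ^ r) \<le> C * norm (h ^ Suc r)"
    by (elim landau_o.bigE)
  have ne: "\<forall>\<^sub>F h::real in at 0. h \<noteq> 0" by (auto simp: eventually_at intro: exI[of _ 1])
  have small: "\<forall>\<^sub>F h::real in at 0. C * \<bar>h\<bar> < \<bar>c\<bar>" using c by (intro eventually_at_0_small) simp
  have "\<forall>\<^sub>F h::real in at 0. False"
    using C(2) ne small
  proof eventually_elim
    case (elim h)
    have "\<bar>c\<bar> * \<bar>h\<bar> ^ r \<le> (C * \<bar>h\<bar>) * \<bar>h\<bar> ^ r" using elim(1) by (simp add: abs_mult power_abs mult_ac)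
    then have "\<bar>c\<bar> \<le> C * \<bar>h\<bar>" using elim(2) by simp
    then show ?case using elim(3) by simp
  qed
  then show False by simp
qed

text \<open>The initial value problem that isolates the tree \<open>\<tau>\<close>.  The coordinates \<open>0, \<dots>, n - 1\<close> are numbered by
  the distinct complete subtrees of \<open>\<tau>\<close>, with \<open>e\<close> and \<open>ix\<close> inverse to each other, and the coordinate \<open>n\<close> is constantly
  \<open>1\<close>.  Isomorphic subtrees share a coordinate, so powers of a coordinate take the place of symmetry
  coefficients.  The functions \<open>q\<close> and \<open>ts\<close> decompose the subtrees that have no meagre root.\<close>

locale lirkw_witness = lirkw s a gam for s and a gam :: "nat \<Rightarrow> nat \<Rightarrow> real" +
  fixes \<tau> :: tree and n :: nat and e :: "nat \<Rightarrow> tree" and ix :: "tree \<Rightarrow> nat"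
    and q :: "tree \<Rightarrow> nat" and ts :: "tree \<Rightarrow> tree multiset"
  assumes a_lower: "\<And>i j. i \<in> {1..s} \<Longrightarrow> j \<in> {1..s} \<Longrightarrow> j \<ge> i \<Longrightarrow> a i j = 0"
    and gam_lower: "\<And>i j. i \<in> {1..s} \<Longrightarrow> j \<in> {1..s} \<Longrightarrow> j > i \<Longrightarrow> gam i j = 0"
    and \<tau>: "\<tau> \<in> LW3"
    and e: "\<And>\<nu>. \<nu> < n \<Longrightarrow> e \<nu> \<in> subtrees \<tau> \<and> ix (e \<nu>) = \<nu>"
    and ix: "\<And>\<sigma>. \<sigma> \<in> subtrees \<tau> \<Longrightarrow> ix \<sigma> < n \<and> e (ix \<sigma>) = \<sigma>"
    and theta: "\<And>\<sigma>. \<sigma> \<in> subtrees \<tau> \<Longrightarrow> root \<sigma> \<noteq> Meagre \<Longrightarrow> \<sigma> = theta (q \<sigma>) (ts \<sigma>)"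
begin

definition vec :: "(tree \<Rightarrow> real) \<Rightarrow> nat \<Rightarrow> real" where
  "vec w \<nu> = (if \<nu> < n then w (e \<nu>) else if \<nu> = n then 1 else 0)"

text \<open>The column of the nonzero entry of \<open>L\<close>: the coordinate of the child of the fat vertex, or the constant
  coordinate if the fat vertex is a leaf.\<close>

definition col :: "tree multiset \<Rightarrow> nat" where
  "col us = (if us = {#} then n else ix (SOME \<sigma>. us = {#\<sigma>#}))"

definition F :: "(nat \<Rightarrow> real) \<Rightarrow> nat \<Rightarrow> real" where
  "F x \<nu> = (if \<nu> < n \<and> root (e \<nu>) = Meagre then \<Prod>\<sigma>\<in>#children (e \<nu>). x (ix \<sigma>) else 0)"

definition L :: "real \<Rightarrow> nat \<Rightarrow> nat \<Rightarrow> real" where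
  "L t \<nu> \<mu> = (if \<nu> < n \<and> root (e \<nu>) \<noteq> Meagre \<and> \<mu> = col (ts (e \<nu>)) then 1 else 0) * t ^ q (e \<nu>)"

text \<open>The values of the stages and, for \<open>i = 0\<close>, of the exact solution.  At \<open>h = 0\<close> this is the initial value.\<close>

definition Y :: "nat \<Rightarrow> real \<Rightarrow> nat \<Rightarrow> real" where
  "Y i h = vec (\<lambda>\<sigma>. forest_term {#\<sigma>#} i h)"

lemma vec_RN: "vec w \<in> RN (Suc n)"
  by (auto simp: vec_def topspace_Euclidean_space)

lemma subtree_LW3_sub: "\<sigma> \<in> subtrees \<tau> \<Longrightarrow> \<sigma> \<in> LW3_sub"
  using \<tau> LW3_sub_subtree by (auto simp: LW3_iff)

lemma forest_term_prod: "forest_term us i h = (\<Prod>\<sigma>\<in>#us. forest_term {#\<sigma>#} i h)"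
  by (simp add: forest_term_def)

lemma F_Y:
  assumes "\<sigma> \<in> subtrees \<tau>" "\<sigma> = Node Meagre us"
  shows "F (Y i h) (ix \<sigma>) = forest_term us i h"
proof -
  have "Y i h (ix \<rho>) = forest_term {#\<rho>#} i h" if "\<rho> \<in># us" for \<rho>
  proof -
    have "\<rho> \<in> subtrees \<sigma>" using assms(2) that subtrees_refl[of \<rho>] by auto
    then have "\<rho> \<in> subtrees \<tau>" using assms(1) by (rule subtrees_trans)
    then show ?thesis using ix[of \<rho>] by (simp add: Y_def vec_def)
  qed
  then have "(\<Prod>\<rho>\<in>#us. Y i h (ix \<rho>)) = (\<Prod>\<rho>\<in>#us. forest_term {#\<rho>#} i h)"
    by (intro arg_cong[of _ _ prod_mset] image_mset_cong)
  then show ?thesis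
    using assms ix[OF assms(1)] by (simp add: F_def forest_term_prod[of us])
qed

lemma F_zero: "\<nu> \<ge> n \<or> root (e \<nu>) \<noteq> Meagre \<Longrightarrow> F x \<nu> = 0"
  by (auto simp: F_def)

text \<open>For a fat leaf, the empty forest has the term \<open>1\<close>, which is the value of the constant coordinate.\<close>

lemma theta_args:
  assumes "\<sigma> \<in> subtrees \<tau>" "root \<sigma> \<noteq> Meagre"
  shows "size (ts \<sigma>) \<le> 1" "col (ts \<sigma>) < Suc n" "Y i h (col (ts \<sigma>)) = forest_term (ts \<sigma>) i h"
proof -
  have eq: "\<sigma> = theta (q \<sigma>) (ts \<sigma>)" using theta[OF assms] .
  have "theta (q \<sigma>) (ts \<sigma>) \<in> LW3_sub" using subtree_LW3_sub[OF assms(1)] eq by simp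
  then show sz: "size (ts \<sigma>) \<le> 1" by (simp add: theta_in_LW3_sub)
  have "col (ts \<sigma>) < Suc n \<and> Y i h (col (ts \<sigma>)) = forest_term (ts \<sigma>) i h"
  proof (cases "ts \<sigma> = {#}")
    case True
    then show ?thesis by (simp add: col_def Y_def vec_def)
  next
    case False
    then have "size (ts \<sigma>) = 1" using sz by (metis One_nat_def le_Suc_eq le_zero_eq size_eq_0_iff_empty)
    then obtain \<rho> where \<rho>: "ts \<sigma> = {#\<rho>#}" using size_1_singleton_mset by blast
    have "\<rho> \<in> subtrees (theta (q \<sigma>) (ts \<sigma>))"
      using subtrees_theta[of \<rho> "ts \<sigma>" "q \<sigma>"] subtrees_refl[of \<rho>] \<rho> by auto
    then have "\<rho> \<in> subtrees \<tau>" using subtrees_trans[of \<rho> \<sigma> \<tau>] assms(1) eq by simp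
    then show ?thesis using ix[of \<rho>] by (simp add: \<rho> col_def Y_def vec_def)
  qed
  then show "col (ts \<sigma>) < Suc n" "Y i h (col (ts \<sigma>)) = forest_term (ts \<sigma>) i h" by blast+
qed

lemma mat_vec_L:
  assumes "\<sigma> \<in> subtrees \<tau>" "root \<sigma> \<noteq> Meagre"
  shows "mat_vec (Suc n) (L t) x (ix \<sigma>) = t ^ q \<sigma> * x (col (ts \<sigma>))"
proof -
  have "mat_vec (Suc n) (L t) x (ix \<sigma>)
      = (\<Sum>\<mu><Suc n. if \<mu> = col (ts \<sigma>) then t ^ q \<sigma> * x (col (ts \<sigma>)) else 0)"
    unfolding mat_vec_def using ix[OF assms(1)] assms(2)
    by (intro sum.cong) (auto simp: L_def)
  also have "\<dots> = t ^ q \<sigma> * x (col (ts \<sigma>))"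
    using theta_args(2)[OF assms] by (simp add: sum.delta del: sum.lessThan_Suc)
  finally show ?thesis .
qed

lemma mat_vec_L_zero: "\<nu> \<ge> n \<or> root (e \<nu>) = Meagre \<Longrightarrow> mat_vec (Suc n) (L t) x \<nu> = 0"
  by (auto simp: mat_vec_def L_def intro!: sum.neutral)

lemma smooth_F: "smooth_vector_field (Suc n) F"
  unfolding smooth_vector_field_def
proof (intro conjI allI impI)
  show "F \<in> RN (Suc n) \<rightarrow> RN (Suc n)"
    by (auto simp: topspace_Euclidean_space F_def)
  fix \<nu>
  have "polyfun (Suc n) (\<lambda>x. F x \<nu>)"
  proof (cases "\<nu> < n \<and> root (e \<nu>) = Meagre")
    case True
    have "ix \<sigma> < Suc n" if "\<sigma> \<in># children (e \<nu>)" for \<sigma>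
    proof -
      have "\<sigma> \<in> subtrees (e \<nu>)" using that subtrees_refl[of \<sigma>] by (cases "e \<nu>") auto
      then have "\<sigma> \<in> subtrees \<tau>" using subtrees_trans[of \<sigma> "e \<nu>" \<tau>] e True by blast
      then show ?thesis using ix[of \<sigma>] by simp
    qed
    then have "polyfun (Suc n) (\<lambda>x. \<Prod>\<sigma>\<in>#children (e \<nu>). x (ix \<sigma>))"
      by (intro polyfun_prod_mset polyfun.coord)
    then show ?thesis using True by (simp add: F_def)
  next
    case False
    then have "(\<lambda>x. F x \<nu>) = (\<lambda>x. 0)" by (auto simp: F_def)
    then show ?thesis by (simp add: polyfun.const)
  qed
  then show "smooth_RN (Suc n) (\<lambda>x. F x \<nu>)" by (rule smooth_RN_polyfun)
qed

lemma smooth_L: "smooth_matrix (Suc n) L"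
  unfolding smooth_matrix_def L_def by (intro allI impI monomial_iterated_deriv_differentiable)

text \<open>The coordinates of meagre subtrees satisfy \<open>\<sigma>' = \<Prod>\<close> of their children by
  \<open>forest_term_Meagre_exact\<close>; those of the other subtrees stay \<open>0\<close>.\<close>

lemma exact_solution: "local_solution (Suc n) F 0 (Y 0 0) (Y 0)"
  unfolding local_solution_def
proof (intro conjI refl exI[of _ 1] allI impI)
  fix t :: real and \<nu> assume "\<nu> < Suc n"
  show "((\<lambda>h. Y 0 h \<nu>) has_real_derivative F (Y 0 t) \<nu>) (at t)"
  proof (cases "\<nu> < n")
    case True
    then have \<sigma>: "e \<nu> \<in> subtrees \<tau>" "ix (e \<nu>) = \<nu>" using e by auto
    have Y: "(\<lambda>h. Y 0 h \<nu>) = forest_term {#e \<nu>#} 0" using True by (auto simp: Y_def vec_def)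
    show ?thesis
    proof (cases "root (e \<nu>) = Meagre")
      case True
      then obtain us where us: "e \<nu> = Node Meagre us" by (cases "e \<nu>") auto
      show ?thesis unfolding Y using F_Y[OF \<sigma>(1) us, of 0 t] forest_term_Meagre_exact[of us t] \<sigma>(2) us
        by simp
    next
      case False
      then have "forest_term {#e \<nu>#} 0 = (\<lambda>h. 0)"
        using theta[OF \<sigma>(1) False] forest_term_theta_exact[of "q (e \<nu>)" "ts (e \<nu>)"] by (metis ext)
      then show ?thesis unfolding Y using False by (simp add: F_zero)
    qed
  next
    case False
    then have "(\<lambda>h. Y 0 h \<nu>) = (\<lambda>h. 1)" using \<open>\<nu> < Suc n\<close> by (auto simp: Y_def vec_def)
    then show ?thesis using False by (simp add: F_zero)
  qed
qed (auto simp: Y_def vec_RN)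

lemma Y_stages:
  assumes i: "i \<in> {1..s}" and \<nu>: "\<nu> < Suc n"
  shows "Y i h \<nu> = Y 0 0 \<nu> + h * (\<Sum>j\<in>{1..<i}. a i j * F (Y j h) \<nu>)
    + h * mat_vec (Suc n) (L (0 + h * gam i i)) (\<lambda>\<mu>. \<Sum>j=1..i. gam i j * Y j h \<mu>) \<nu>"
proof (cases "\<nu> < n")
  case True
  then have \<sigma>: "e \<nu> \<in> subtrees \<tau>" "ix (e \<nu>) = \<nu>" using e by auto
  have Y: "Y i h \<nu> = forest_term {#e \<nu>#} i h" "Y 0 0 \<nu> = forest_term {#e \<nu>#} 0 0"
    using True by (simp_all add: Y_def vec_def)
  show ?thesis
  proof (cases "root (e \<nu>) = Meagre")
    case True
    then obtain us where us: "e \<nu> = Node Meagre us" by (cases "e \<nu>") auto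
    have "(\<Sum>j\<in>{1..<i}. a i j * F (Y j h) \<nu>) = (\<Sum>j=1..s. a i j * F (Y j h) \<nu>)"
      using i by (intro sum.mono_neutral_left) (auto intro: a_lower)
    then show ?thesis
      unfolding Y using F_Y[OF \<sigma>(1) us] \<sigma>(2) us True
      by (simp add: mat_vec_L_zero forest_term_Meagre_exact_0 forest_term_Meagre[OF i])
  next
    case False
    have eq: "e \<nu> = theta (q (e \<nu>)) (ts (e \<nu>))" using theta[OF \<sigma>(1) False] .
    have "(\<Sum>j=1..i. gam i j * Y j h (col (ts (e \<nu>)))) = (\<Sum>j=1..s. gam i j * Y j h (col (ts (e \<nu>))))"
      using i by (intro sum.mono_neutral_left) (auto intro: gam_lower)
    also have "\<dots> = (\<Sum>j=1..s. gam i j * forest_term (ts (e \<nu>)) j h)"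
      using theta_args(3)[OF \<sigma>(1) False] by simp
    finally have "mat_vec (Suc n) (L (0 + h * gam i i)) (\<lambda>\<mu>. \<Sum>j=1..i. gam i j * Y j h \<mu>) \<nu>
        = (h * gam i i) ^ q (e \<nu>) * (\<Sum>j=1..s. gam i j * forest_term (ts (e \<nu>)) j h)"
      using mat_vec_L[OF \<sigma>(1) False] \<sigma>(2) by simp
    moreover have "forest_term {#e \<nu>#} i h
        = h * (h * gam i i) ^ q (e \<nu>) * (\<Sum>j=1..s. gam i j * forest_term (ts (e \<nu>)) j h)"
      using forest_term_theta[OF i theta_args(1)[OF \<sigma>(1) False], of "q (e \<nu>)" h] eq by simp
    moreover have "forest_term {#e \<nu>#} 0 0 = 0"
      using forest_term_theta_exact[of "q (e \<nu>)" "ts (e \<nu>)" 0] eq by simp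
    ultimately show ?thesis
      unfolding Y using False by (simp add: F_zero)
  qed
next
  case False
  then show ?thesis using \<nu> by (simp add: F_zero mat_vec_L_zero Y_def vec_def)
qed

text \<open>With the stages known, the step is explicit, and its error in the coordinate of \<open>\<tau>\<close> is a
  monomial of degree \<open>\<rho>(\<tau>) \<le> p\<close> that is \<open>O(h\<^bsup>p+1\<^esup>)\<close>.\<close>

lemma condition_if_order:
  assumes order: "lirkw_has_order s a gam b g p" and p: "tree_order \<tau> \<le> p"
  shows "(\<Sum>j=1..s. Phi s a gam b g \<tau> j) = exact_weight \<tau>"
proof -
  define z where "z = (\<lambda>h \<nu>. if \<nu> < Suc n then Y 0 0 \<nu> + h * (\<Sum>j=1..s. b j * F (Y j h) \<nu>)
      + h * mat_vec (Suc n) (L 0) (\<lambda>\<mu>. \<Sum>j=1..s. g j * Y j h \<mu>) \<nu> else 0)"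
  have "lirkw_step s a gam b g (Suc n) F L 0 (Y 0 0) h (z h)" for h
    unfolding lirkw_step_def
  proof (intro conjI exI[of _ "\<lambda>i. Y i h"] ballI allI impI)
    show "z h \<in> RN (Suc n)" by (simp add: z_def topspace_Euclidean_space)
    show "Y i h \<in> RN (Suc n)" for i by (simp add: Y_def vec_RN)
  qed (simp_all only: Y_stages z_def if_True)
  then have step: "\<forall>\<^sub>F h in nhds 0. lirkw_step s a gam b g (Suc n) F L 0 (Y 0 0) h (z h)"
    by simp
  have \<tau>': "\<tau> \<in> subtrees \<tau>" by (rule subtrees_refl)
  have yn: "Y 0 0 \<in> RN (Suc n)" by (simp add: Y_def vec_RN)
  have ix': "ix \<tau> < Suc n" "e (ix \<tau>) = \<tau>" using ix[OF \<tau>'] by auto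
  have big: "(\<lambda>h. z h (ix \<tau>) - Y 0 (0 + h) (ix \<tau>)) \<in> O[at 0](\<lambda>h. h ^ (p + 1))"
    using order[unfolded lirkw_has_order_def, rule_format,
        OF smooth_F smooth_L yn exact_solution step ix'(1)] .
  have Y0: "Y 0 h (ix \<tau>) = h ^ tree_order \<tau> * exact_weight \<tau>" for h
    using ix[OF \<tau>'] by (simp add: Y_def vec_def forest_term_def weight_def)
  have ord: "tree_order \<tau> > 0" by (cases \<tau>) simp
  have "z h (ix \<tau>) = h ^ tree_order \<tau> * (\<Sum>j=1..s. Phi s a gam b g \<tau> j)" for h
  proof (cases "root \<tau> = Meagre")
    case True
    then obtain us where us: "\<tau> = Node Meagre us" by (cases \<tau>) auto
    have "z h (ix \<tau>) = h * (\<Sum>j=1..s. b j * F (Y j h) (ix \<tau>))"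
      using ix' True ord by (simp add: z_def Y0 mat_vec_L_zero)
    also have "\<dots> = h * (\<Sum>j=1..s. b j * forest_term us j h)"
      using F_Y[OF \<tau>' us] by simp
    finally show ?thesis using forest_term_result_Meagre[of h b us g] us by simp
  next
    case False
    then have "root \<tau> = Fat" using \<tau> by (cases "root \<tau>") (auto simp: LW3_iff)
    moreover have eq: "\<tau> = theta (q \<tau>) (ts \<tau>)" using theta[OF \<tau>' False] .
    \<comment> \<open>The root is fat, so no power of \<open>t\<close> vanishes at \<open>t\<^sub>n = 0\<close>: the entry of \<open>L 0\<close> is \<open>1\<close>.\<close>
    ultimately have q: "q \<tau> = 0" using root_theta[of "q \<tau>" "ts \<tau>"] by (auto split: if_splits)
    then have us: "\<tau> = Node Fat (ts \<tau>)" using eq by simp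
    have "z h (ix \<tau>) = h * (\<Sum>j=1..s. g j * Y j h (col (ts \<tau>)))"
      using ix' False ord mat_vec_L[OF \<tau>' False, of 0] q by (simp add: z_def Y0 F_zero)
    also have "\<dots> = h * (\<Sum>j=1..s. g j * forest_term (ts \<tau>) j h)"
      using theta_args(3)[OF \<tau>' False] by simp
    finally show ?thesis using forest_term_result_Fat[of h g "ts \<tau>" b] us by simp
  qed
  then have "(\<lambda>h. ((\<Sum>j=1..s. Phi s a gam b g \<tau> j) - exact_weight \<tau>) * h ^ tree_order \<tau>) \<in> O[at 0](\<lambda>h. h ^ Suc p)"
    using big by (simp add: Y0 algebra_simps)
  then show ?thesis using power_coefficient_zero p by fastforce
qed

end

theorem (in lirkw) condition_if_order:
  assumes a_lower: "\<And>i j. i \<in> {1..s} \<Longrightarrow> j \<in> {1..s} \<Longrightarrow> j \<ge> i \<Longrightarrow> a i j = 0"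
    and gam_lower: "\<And>i j. i \<in> {1..s} \<Longrightarrow> j \<in> {1..s} \<Longrightarrow> j > i \<Longrightarrow> gam i j = 0"
    and order: "lirkw_has_order s a gam b g p" and \<tau>: "\<tau> \<in> LW3"
    and \<tau>_order: "tree_order \<tau> \<le> p"
  shows "(\<Sum>j=1..s. Phi s a gam b g \<tau> j) = exact_weight \<tau>"
proof -
  obtain e n where "bij_betw e {0..<n::nat} (subtrees \<tau>)"
    using ex_bij_betw_nat_finite[OF finite_subtrees] by blast
  then have e: "inj_on e {0..<n}" "e ` {0..<n} = subtrees \<tau>" by (auto simp: bij_betw_def)
  have "\<forall>\<sigma>. \<exists>q ts. \<sigma> \<in> subtrees \<tau> \<longrightarrow> root \<sigma> \<noteq> Meagre \<longrightarrow> \<sigma> = theta q ts"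
    using LW3_sub_non_Meagre_theta LW3_sub_subtree \<tau> LW3_iff by blast
  then obtain q ts where q: "\<And>\<sigma>. \<sigma> \<in> subtrees \<tau> \<Longrightarrow> root \<sigma> \<noteq> Meagre \<Longrightarrow> \<sigma> = theta (q \<sigma>) (ts \<sigma>)"
    by metis
  interpret lirkw_witness s a gam \<tau> n e "inv_into {0..<n} e" q ts
  proof
    show "e \<nu> \<in> subtrees \<tau> \<and> inv_into {0..<n} e (e \<nu>) = \<nu>" if "\<nu> < n" for \<nu>
      using e that by auto
    show "inv_into {0..<n} e \<sigma> < n \<and> e (inv_into {0..<n} e \<sigma>) = \<sigma>" if "\<sigma> \<in> subtrees \<tau>" for \<sigma>
      using that e(2) inv_into_into[of \<sigma> e "{0..<n}"] f_inv_into_f[of \<sigma> e "{0..<n}"] by auto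
  qed (fact a_lower gam_lower \<tau> | erule (1) q)+
  show ?thesis using order \<tau>_order by (rule condition_if_order)
qed


section \<open>The order conditions\<close>


theorem theorem3p3:
  fixes p s :: nat
    and a gam :: "nat \<Rightarrow> nat \<Rightarrow> real"
    and b g :: "nat \<Rightarrow> real"
  assumes "p \<ge> 1"
    and "\<And>i j. i \<in> {1..s} \<Longrightarrow> j \<in> {1..s} \<Longrightarrow> j \<ge> i \<Longrightarrow> a i j = 0"
    and "\<And>i j. i \<in> {1..s} \<Longrightarrow> j \<in> {1..s} \<Longrightarrow> j > i \<Longrightarrow> gam i j = 0"
  shows "lirkw_has_order s a gam b g p \<longleftrightarrow>
    (\<forall>\<tau>\<in>meagre_trees. tree_order \<tau> \<le> p \<longrightarrow>
       (\<Sum>j=1..s. Phi s a gam b g \<tau> j) = 1 / real (tree_density \<tau>)) \<and>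
    (\<forall>\<tau>\<in>LW3 - meagre_trees. tree_order \<tau> \<le> p \<longrightarrow>
       (\<Sum>j=1..s. Phi s a gam b g \<tau> j) = 0)"
proof -
  have "(\<forall>\<tau>\<in>meagre_trees. tree_order \<tau> \<le> p \<longrightarrow>
       (\<Sum>j=1..s. Phi s a gam b g \<tau> j) = 1 / real (tree_density \<tau>)) \<and>
    (\<forall>\<tau>\<in>LW3 - meagre_trees. tree_order \<tau> \<le> p \<longrightarrow>
       (\<Sum>j=1..s. Phi s a gam b g \<tau> j) = 0)
    \<longleftrightarrow> lirkw.conditions s a gam b g p" (is "?conds \<longleftrightarrow> _")
    unfolding lirkw.conditions_def
    using exact_weight_LW3 by (auto simp: meagre_trees_def)
  moreover have "lirkw_has_order s a gam b g p" if "lirkw.conditions s a gam b g p"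
    by (rule lirkw.order_if_conditions[OF _ that assms(2,3)]) (use assms(1) in auto)
  moreover have "lirkw.conditions s a gam b g p" if "lirkw_has_order s a gam b g p"
    unfolding lirkw.conditions_def
    using lirkw.condition_if_order[OF assms(2,3) that] by blast
  ultimately show ?thesis by blast
qed

end
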